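(* Let $(a_k)_{k\geqslant 1}$ be a sequence of complex numbers such that \[ S(n)=\sum_{k\leqslant n}a_k\left[\frac{n}{k}\right]\log k=o(n\log n)\quad\text{as } n\to\infty . \] Then the Dirichlet series $g(\sigma)=\sum_{m=1}^\infty a_m m^{-\sigma}$ converges for every real $\sigma>1$, and \[ \frac{1}{n}\sum_{k\leqslant n}a_k\left[\frac{n}{k}\right]=g\left(1+\frac{1}{\log n}\right)+o(1)\quad\text{as } n\to\infty . \]
   Context: $[x]$ denotes the integer part of a real number $x$. *)

theory Defs
  imports "HOL-Analysis.Analysis" "HOL-Library.Landau_Symbols"
begin

definition dser :: "(nat \<Rightarrow> complex) \<Rightarrow> real \<Rightarrow> complex" where
  "dser a \<sigma> = (\<Sum>m. a (Suc m) * of_real (real (Suc m) powr (- \<sigma>)))"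

end

theory Submission
  imports Defs "HOL-Computational_Algebra.Squarefree" "HOL-Real_Asymp.Real_Asymp"
begin

text \<open>
  Put \<open>b k = a k * ln k\<close>, \<open>F n = (\<Sum>k\<le>n. a k * (n div k))\<close> and \<open>\<alpha> n = F n / n\<close>. The heart of the proof is that
  \<open>\<alpha>\<close> oscillates slowly: \<open>\<alpha> N - \<alpha> n\<close> tends to 0 uniformly for \<open>n \<le> N \<le> n\<^sup>2\<close>.

  For \<open>w r k = max 0 (1 - r * ln k) ^ 8\<close> the derivative in \<open>r\<close> of \<open>\<Sum>k\<le>n. a k * w r k * (n div k)\<close> is
  \<open>- 8\<close> times the sum \<open>\<Sum>k\<le>n. b k * max 0 (1 - r * ln k) ^ 7 * (n div k)\<close>. Moebius inversion and partial
  summation express the latter through \<open>S\<close> with a kernel built from the sieve weights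
  \<open>\<Sum>d | d dvd j. \<mu> d * max 0 (1 - r * ln m - r * ln d) ^ 7\<close>. These are iterated differences of a smooth function
  with steps \<open>r * ln p\<close>, \<open>p\<close> a prime factor of \<open>j\<close>, hence small unless \<open>j\<close> has few small prime factors. For
  \<open>r = O(1 / ln n)\<close> their logarithmic averages over \<open>j \<le> n\<close> are bounded, so the sum is \<open>o(n * ln n)\<close> and
  \<open>F n\<close> equals the truncated sum up to \<open>o(n)\<close>. Choosing \<open>r = 8 / ln n\<close> truncates at \<open>n powr (1 / 8)\<close>, where the
  integer parts are harmless, and slow oscillation follows.

  Finally \<open>\<zeta>(\<sigma>) g(\<sigma>)\<close> is the Dirichlet series of the divisor sum of \<open>a\<close>, so \<open>g(1 + 1 / ln n)\<close> is a weighted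
  average of the \<open>\<alpha> N\<close>, concentrated on \<open>ln N\<close> comparable to \<open>ln n\<close>, and therefore \<open>\<alpha> n + o(1)\<close>.
\<close>

section \<open>Divisor sums and Moebius inversion\<close>

text \<open>A pair \<open>d dvd k\<close> is the same as a factorisation \<open>k = d * e\<close>,
  so both sides run over the pairs with product at most \<open>n\<close>. With \<open>h\<close>
  arbitrary, this rearranges the summatory functions of the Dirichlet convolutions below.\<close>

lemma sum_divisors_hyperbola:
  fixes h :: "nat \<Rightarrow> nat \<Rightarrow> 'a::comm_monoid_add"
  shows "(\<Sum>k=1..n. \<Sum>d | d dvd k. h d (k div d)) = (\<Sum>d=1..n. \<Sum>e=1..n div d. h d e)"
proof -
  have "(\<Sum>k=1..n. \<Sum>d | d dvd k. h d (k div d))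
      = (\<Sum>(k, d)\<in>(SIGMA k:{1..n}. {d. d dvd k}). h d (k div d))"
    by (subst sum.Sigma) (auto simp: finite_divisors_nat)
  also have "\<dots> = (\<Sum>(d, e)\<in>(SIGMA d:{1..n}. {1..n div d}). h d e)"
  proof (rule sum.reindex_bij_witness[where i = "\<lambda>(d, e). (d * e, d)" and j = "\<lambda>(k, d). (d, k div d)"],
         goal_cases)
    case (2 x)
    then obtain k d where x: "x = (k, d)" "1 \<le> k" "k \<le> n" "d dvd k" by auto
    then have "1 \<le> d" "d \<le> k" by (auto simp: dvd_pos_nat Suc_leI intro: dvd_imp_le)
    moreover have "k div d \<ge> 1" using x \<open>d \<le> k\<close> \<open>1 \<le> d\<close> by (simp add: Suc_leI div_greater_zero_iff)
    ultimately show ?case using x by (auto intro: div_le_mono)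
  next
    case (4 x)
    then obtain d e where x: "x = (d, e)" "1 \<le> d" "d \<le> n" "1 \<le> e" "e \<le> n div d" by auto
    then have "d * e \<le> n" by (metis mult.commute div_mult_self1_is_m less_eq_div_iff_mult_less_eq less_le_trans zero_less_one)
    then show ?case using x by auto
  qed auto
  also have "\<dots> = (\<Sum>d=1..n. \<Sum>e=1..n div d. h d e)"
    by (subst sum.Sigma) auto
  finally show ?thesis .
qed

lemma sum_divisors_flip:
  fixes h :: "nat \<Rightarrow> nat \<Rightarrow> 'a::comm_monoid_add"
  assumes "k \<ge> 1"
  shows "(\<Sum>d | d dvd k. h d (k div d)) = (\<Sum>d | d dvd k. h (k div d) d)"
  by (rule sum.reindex_bij_witness[where i = "\<lambda>d. k div d" and j = "\<lambda>d. k div d"])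
     (use assms in \<open>auto elim!: dvdE\<close>)

lemma sum_atMost_div_swap:
  fixes h :: "nat \<Rightarrow> nat \<Rightarrow> 'a::comm_monoid_add"
  shows "(\<Sum>d=1..n. \<Sum>e=1..n div d. h d e) = (\<Sum>e=1..n. \<Sum>d=1..n div e. h d e)"
proof -
  have "(\<Sum>d=1..n. \<Sum>e=1..n div d. h d e) = (\<Sum>k=1..n. \<Sum>d | d dvd k. h d (k div d))"
    by (rule sum_divisors_hyperbola[symmetric])
  also have "\<dots> = (\<Sum>k=1..n. \<Sum>d | d dvd k. h (k div d) d)"
    by (intro sum.cong refl sum_divisors_flip) auto
  also have "\<dots> = (\<Sum>e=1..n. \<Sum>d=1..n div e. h d e)"
    using sum_divisors_hyperbola[of "\<lambda>e d. h d e" n] by simp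
  finally show ?thesis .
qed

text \<open>Exactly \<open>n div k\<close> of the numbers up to \<open>n\<close> are multiples of
  \<open>k\<close>. Read from right to left, a floor sum is the summatory function of a divisor sum,
  which opens it to partial summation.\<close>

lemma sum_sum_divisors:
  fixes u :: "nat \<Rightarrow> 'a::comm_semiring_1"
  shows "(\<Sum>j=1..n. \<Sum>k | k dvd j. u k) = (\<Sum>k=1..n. u k * of_nat (n div k))"
  using sum_divisors_hyperbola[of "\<lambda>d e. u d" n] by (simp add: mult.commute)

section \<open>The Moebius function and inversion\<close>

definition mob :: "nat \<Rightarrow> real" where
  "mob d = (if squarefree d then (- 1) ^ card (prime_factors d) else 0)"

lemma abs_mob_le: "\<bar>mob d\<bar> \<le> 1"
  by (simp add: mob_def power_abs)

text \<open>A set of primes can be read off its product. Together with the next lemma this matches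
  the squarefree divisors of a number with the subsets of its prime factors.\<close>

lemma prod_primes_factors:
  fixes D :: "nat set"
  assumes "finite D" "\<And>p. p \<in> D \<Longrightarrow> prime p"
  shows "prime_factors (\<Prod>D) = D" "squarefree (\<Prod>D)"
proof -
  have nz: "\<Prod>D \<noteq> 0" using assms by (auto simp: prod_zero_iff dest: assms(2))
  have "prime_factorization (\<Prod>D) = (\<Sum>p\<in>D. prime_factorization p)"
    using assms by (subst prime_factorization_prod) (auto dest: assms(2) intro: prime_gt_0_nat)
  also have "\<dots> = (\<Sum>p\<in>D. {#p#})" using assms by (intro sum.cong) (auto simp: prime_factorization_prime)
  also have "\<dots> = mset_set D" using assms(1) by (induction D rule: finite_induct) auto
  finally have *: "prime_factorization (\<Prod>D) = mset_set D" .
  then show pf: "prime_factors (\<Prod>D) = D" using assms by simp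
  have "multiplicity p (\<Prod>D) \<le> 1" if "prime p" for p
    using * that assms(1) count_prime_factorization_prime[OF that, of "\<Prod>D"]
    by (cases "p \<in> D") (simp_all add: count_mset_set')
  then show "squarefree (\<Prod>D)"
    using squarefree_factorial_semiring''[OF nz] by blast
qed

lemma squarefree_prod_prime_factors:
  fixes d :: nat
  assumes sf: "squarefree d"
  shows "d = \<Prod>(prime_factors d)"
proof -
  have d0: "d \<noteq> 0" using sf by (intro notI) simp
  have "d = (\<Prod>p\<in>prime_factors d. p ^ multiplicity p d)"
    using d0 by (simp add: prod_prime_factors)
  also have "\<dots> = \<Prod>(prime_factors d)"
  proof (rule prod.cong)
    fix p assume p: "p \<in> prime_factors d"
    then have "multiplicity p d \<le> 1" using sf d0 squarefree_factorial_semiring'' by blast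
    moreover have "multiplicity p d > 0" using p by (auto simp: prime_factors_multiplicity)
    ultimately show "p ^ multiplicity p d = p" by (simp add: le_Suc_eq)
  qed simp
  finally show ?thesis .
qed

text \<open>Only squarefree divisors contribute, and they are the products of sets of prime factors.
  The right side becomes an iterated difference as soon as \<open>f\<close> is a function of the
  logarithm.\<close>

lemma sum_mob_divisors:
  fixes f :: "nat \<Rightarrow> real"
  assumes "j \<ge> 1"
  shows "(\<Sum>d | d dvd j. mob d * f d) = (\<Sum>D\<in>Pow (prime_factors j). (- 1) ^ card D * f (\<Prod>D))"
proof -
  have "(\<Sum>d | d dvd j. mob d * f d) = (\<Sum>d | d dvd j \<and> squarefree d. mob d * f d)"
    by (rule sum.mono_neutral_right) (use assms in \<open>auto simp: mob_def\<close>)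
  also have "\<dots> = (\<Sum>D\<in>Pow (prime_factors j). (- 1) ^ card D * f (\<Prod>D))"
  proof (rule sum.reindex_bij_witness[where i = "\<lambda>D. \<Prod>D" and j = prime_factors], goal_cases)
    case (1 d)
    then have sf: "squarefree d" by simp
    show ?case using squarefree_prod_prime_factors[OF sf] ..
  next
    case (2 d) then show ?case using assms by (auto intro: dvd_prime_factors[THEN subsetD, rotated])
  next
    case (3 D) then show ?case by (intro prod_primes_factors) (auto intro: finite_subset)
  next
    case (4 D)
    then have D: "finite D" "D \<subseteq> prime_factors j" by (auto intro: finite_subset)
    have "\<Prod>D dvd \<Prod>(prime_factors j)" using D by (intro prod_dvd_prod_subset) auto
    also have "\<dots> dvd (\<Prod>p\<in>prime_factors j. p ^ multiplicity p j)"
      by (intro prod_dvd_prod dvd_power) (auto simp: prime_factors_multiplicity)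
    also have "\<dots> = j" using assms by (simp add: prod_prime_factors)
    finally show ?case using prod_primes_factors(2)[of D] D by auto
  next
    case (5 d) 
    then have sf: "squarefree d" by simp
    show ?case using sf squarefree_prod_prime_factors[OF sf] by (simp add: mob_def)
  qed
  finally show ?thesis .
qed

lemma sum_Pow_insert:
  fixes f :: "'a set \<Rightarrow> 'b::comm_monoid_add"
  assumes "finite P" "p \<notin> P"
  shows "(\<Sum>D\<in>Pow (insert p P). f D) = (\<Sum>D\<in>Pow P. f D) + (\<Sum>D\<in>Pow P. f (insert p D))"
proof -
  have inj: "inj_on (insert p) (Pow P)" using assms by (auto simp: inj_on_def)
  show ?thesis unfolding Pow_insert
    by (subst sum.union_disjoint) (use assms inj in \<open>auto simp: sum.reindex\<close>)
qed

lemma sum_mob: 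
  assumes "j \<ge> 1"
  shows "(\<Sum>d | d dvd j. mob d) = (if j = 1 then 1 else 0)"
proof -
  have *: "(\<Sum>D\<in>Pow P. (- 1 :: real) ^ card D) = (if P = {} then 1 else 0)" if "finite P" for P :: "nat set"
    using that
  proof (induction P rule: finite_induct)
    case (insert p P)
    have "(\<Sum>D\<in>Pow P. (- 1 :: real) ^ card (insert p D)) = (\<Sum>D\<in>Pow P. - ((- 1) ^ card D))"
      by (intro sum.cong refl, subst card_insert_disjoint) (use insert in \<open>auto intro: finite_subset\<close>)
    then show ?case using insert by (simp add: sum_Pow_insert sum_negf)
  qed auto
  have "prime_factors j = {} \<longleftrightarrow> j = 1"
    using assms by (simp add: prime_factorization_empty_iff)
  then show ?thesis using sum_mob_divisors[OF assms, of "\<lambda>_. 1"] * by simp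
qed

text \<open>The pairs with \<open>d * i\<close> dividing \<open>k\<close> are symmetric in
  \<open>d\<close> and \<open>i\<close>. After the swap the inner sum of \<open>mob\<close> over the
  divisors of \<open>k div i\<close> vanishes unless \<open>i = k\<close>.\<close>

lemma mob_inversion:
  fixes u :: "nat \<Rightarrow> complex"
  assumes "k \<ge> 1"
  shows "(\<Sum>d | d dvd k. of_real (mob d) * (\<Sum>i | i dvd (k div d). u i)) = u k"
proof -
  have "(\<Sum>d | d dvd k. of_real (mob d) * (\<Sum>i | i dvd (k div d). u i))
      = (\<Sum>d | d dvd k. \<Sum>i | i dvd (k div d). of_real (mob d) * u i)"
    by (simp add: sum_distrib_left)
  also have "\<dots> = (\<Sum>(d, i)\<in>(SIGMA d:{d. d dvd k}. {i. i dvd k div d}). of_real (mob d) * u i)"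
    by (rule sum.Sigma) (use assms in \<open>auto intro!: finite_divisors_nat elim!: dvdE\<close>)
  also have "\<dots> = (\<Sum>(i, d)\<in>(SIGMA i:{i. i dvd k}. {d. d dvd k div i}). of_real (mob d) * u i)"
    by (rule sum.reindex_bij_witness[where i = prod.swap and j = prod.swap])
       (use assms in \<open>auto elim!: dvdE simp: mult_ac\<close>)
  also have "\<dots> = (\<Sum>i | i dvd k. \<Sum>d | d dvd k div i. of_real (mob d) * u i)"
    by (rule sum.Sigma[symmetric]) (use assms in \<open>auto intro!: finite_divisors_nat elim!: dvdE\<close>)
  also have "\<dots> = (\<Sum>i | i dvd k. of_real (\<Sum>d | d dvd k div i. mob d) * u i)"
    by (simp add: sum_distrib_right)
  also have "\<dots> = (\<Sum>i | i dvd k. if i = k then u k else 0)"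
  proof (rule sum.cong)
    fix i assume i: "i \<in> {i. i dvd k}"
    have "k div i \<ge> 1" using i assms by (auto elim!: dvdE)
    moreover have "k div i = 1 \<longleftrightarrow> i = k" using i assms by (auto elim!: dvdE)
    ultimately show "complex_of_real (sum mob {d. d dvd k div i}) * u i = (if i = k then u k else 0)"
      by (simp add: sum_mob)
  qed simp
  also have "\<dots> = u k" using assms by (simp add: finite_divisors_nat)
  finally show ?thesis .
qed

text \<open>Summing the inversion formula over \<open>k\<close> expresses partial sums through floor
  sums at the points \<open>n div d\<close>. This is how growth bounds for floor sums lead to
  convergence of the Dirichlet series.\<close>

lemma mob_summatory:
  fixes u :: "nat \<Rightarrow> complex"
  shows "(\<Sum>k=1..n. u k) = (\<Sum>d=1..n. of_real (mob d) * (\<Sum>k=1..n div d. u k * of_nat (n div d div k)))"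
proof -
  have "(\<Sum>k=1..n. u k) = (\<Sum>k=1..n. \<Sum>d | d dvd k. of_real (mob d) * (\<Sum>i | i dvd (k div d). u i))"
    by (intro sum.cong refl mob_inversion[symmetric]) auto
  also have "\<dots> = (\<Sum>d=1..n. \<Sum>e=1..n div d. of_real (mob d) * (\<Sum>i | i dvd e. u i))"
    by (rule sum_divisors_hyperbola)
  also have "\<dots> = (\<Sum>d=1..n. of_real (mob d) * (\<Sum>e=1..n div d. \<Sum>i | i dvd e. u i))"
    by (simp add: sum_distrib_left)
  finally show ?thesis by (simp only: sum_sum_divisors)
qed

section \<open>Iterated differences of a smooth cutoff\<close>

text \<open>The alternating sum is an iterated difference of \<open>f i\<close> with steps \<open>a p\<close>: each step in \<open>Q\<close>
  is traded for a derivative by the mean value theorem, every other step costs a factor 2.\<close>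

lemma alternating_difference_bound:
  fixes f :: "nat \<Rightarrow> real \<Rightarrow> real" and a :: "'a \<Rightarrow> real"
  assumes der: "\<And>i x. i < K \<Longrightarrow> (f i has_real_derivative f (Suc i) x) (at x)"
    and bd: "\<And>i x. i \<le> K \<Longrightarrow> x \<ge> 0 \<Longrightarrow> \<bar>f i x\<bar> \<le> M"
    and "finite P" "\<And>p. p \<in> P \<Longrightarrow> a p \<ge> 0" "Q \<subseteq> P" "i + card Q \<le> K" "x \<ge> 0"
  shows "\<bar>\<Sum>D\<in>Pow P. (- 1) ^ card D * f i (x + sum a D)\<bar> \<le> 2 ^ (card P - card Q) * M * prod a Q"
  using assms(3-)
proof (induction P arbitrary: Q i x rule: finite_induct)
  case empty
  then show ?case using bd[of i x] by simp
next
  case (insert p P)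
  define g where "g i x = (\<Sum>D\<in>Pow P. (- 1) ^ card D * f i (x + sum a D))" for i x
  have ap: "a p \<ge> 0" using insert by simp
  \<comment> \<open>Sorting the subsets by whether they contain \<open>p\<close> peels off one
    difference with step \<open>a p\<close>; the minus sign comes from the extra element.\<close>
  have split: "(\<Sum>D\<in>Pow (insert p P). (- 1) ^ card D * f i (x + sum a D)) = g i x - g i (x + a p)"
  proof -
    have "(\<Sum>D\<in>Pow P. (- 1) ^ card (insert p D) * f i (x + sum a (insert p D)))
        = (\<Sum>D\<in>Pow P. - ((- 1) ^ card D * f i (x + a p + sum a D)))"
    proof (intro sum.cong refl)
      fix D assume "D \<in> Pow P"
      then have "finite D" "p \<notin> D" using insert.hyps by (auto intro: finite_subset)
      then show "(- 1) ^ card (insert p D) * f i (x + sum a (insert p D)) = - ((- 1) ^ card D * f i (x + a p + sum a D))"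
        by (simp add: add.assoc)
    qed
    then show ?thesis using insert.hyps by (simp add: sum_Pow_insert g_def sum_negf)
  qed
  have cP: "card (insert p P) = Suc (card P)" using insert.hyps by simp
  show ?case
  proof (cases "p \<in> Q")
    case False
    then have Q: "Q \<subseteq> P" using insert.prems by auto
    have cQ: "card Q \<le> card P" using Q insert.hyps by (intro card_mono)
    have b: "\<bar>g i y\<bar> \<le> 2 ^ (card P - card Q) * M * prod a Q" if "y \<ge> 0" for y
      unfolding g_def using insert.prems Q that by (intro insert.IH) auto
    have "\<bar>g i x - g i (x + a p)\<bar> \<le> \<bar>g i x\<bar> + \<bar>g i (x + a p)\<bar>" by linarith
    also have "\<dots> \<le> 2 * (2 ^ (card P - card Q) * M * prod a Q)"
      using b[of x] b[of "x + a p"] insert.prems ap by simp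
    also have "\<dots> = 2 ^ (card (insert p P) - card Q) * M * prod a Q"
      using cP cQ by (simp add: Suc_diff_le)
    finally show ?thesis by (simp only: split)
  next
    case True
    define Q' where "Q' = Q - {p}"
    have finQ: "finite Q" using insert by (meson finite_insert finite_subset)
    have Q': "Q' \<subseteq> P" "card Q = Suc (card Q')" "prod a Q = a p * prod a Q'"
      using True insert.prems finQ card_Suc_Diff1[OF finQ True] by (auto simp: Q'_def prod.remove)
    have iK: "i < K" using insert.prems Q' by simp
    have b: "\<bar>g (Suc i) y\<bar> \<le> 2 ^ (card P - card Q') * M * prod a Q'" if "y \<ge> 0" for y
      unfolding g_def using insert.prems Q' that by (intro insert.IH) auto
    \<comment> \<open>Differentiation commutes with the remaining differences, so the derivative
      falls under the induction hypothesis at \<open>Suc i\<close> with the smaller set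
      \<open>Q'\<close>.\<close>
    have d: "(g i has_real_derivative g (Suc i) y) (at y)" for y
      unfolding g_def by (auto intro!: derivative_eq_intros DERIV_chain'[OF _ der[OF iK]] simp: iK mult.commute)
    have "\<bar>g i x - g i (x + a p)\<bar> \<le> a p * (2 ^ (card P - card Q') * M * prod a Q')"
    proof (cases "a p = 0")
      case False
      then have "x < x + a p" using ap by simp
      from MVT2[OF this d] obtain z where z: "x < z" "g i (x + a p) - g i x = a p * g (Suc i) z" by auto
      then have "\<bar>g i x - g i (x + a p)\<bar> = a p * \<bar>g (Suc i) z\<bar>"
        using ap by (metis abs_minus_commute abs_mult abs_of_nonneg)
      also have "\<dots> \<le> a p * (2 ^ (card P - card Q') * M * prod a Q')"
        using b[of z] z insert.prems ap by (intro mult_left_mono) auto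
      finally show ?thesis .
    qed simp
    also have "\<dots> = 2 ^ (card (insert p P) - card Q) * M * prod a Q"
      using Q' cP by simp
    finally show ?thesis by (simp only: split)
  qed
qed

text \<open>Away from 1 the function is a polynomial or zero. At 1 the exponent \<open>k + 2\<close>
  is large enough for the difference quotient to be at most \<open>\<bar>h\<bar> ^ (k + 1)\<close>,
  so the two pieces join differentiably.\<close>

lemma has_real_derivative_pos_part_power:
  fixes x :: real
  shows "((\<lambda>x. max 0 (1 - x) ^ (k + 2)) has_real_derivative - real (k + 2) * max 0 (1 - x) ^ (k + 1)) (at x)"
proof -
  consider "x < 1" | "x > 1" | "x = 1" by linarith
  then show ?thesis
  proof cases
    case 1
    have "((\<lambda>x. 1 - x) has_real_derivative - 1) (at x)"
      by (auto intro!: derivative_eq_intros)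
    from DERIV_power[OF this, of "k + 2"]
    have "((\<lambda>x. (1 - x) ^ (k + 2)) has_real_derivative - real (k + 2) * max 0 (1 - x) ^ (k + 1)) (at x)"
      by (rule DERIV_cong) (use 1 in \<open>simp add: algebra_simps\<close>)
    then show ?thesis
      by (rule has_field_derivative_transform_within_open[where S = "{..<1}"]) (use 1 in auto)
  next
    case 2
    have "((\<lambda>x. 0) has_real_derivative - real (k + 2) * max 0 (1 - x) ^ (k + 1)) (at x)"
      using 2 by (auto intro!: derivative_eq_intros simp: max_def)
    then show ?thesis
      by (rule has_field_derivative_transform_within_open[where S = "{1<..}"]) (use 2 in auto)
  next
    case 3
    have "((\<lambda>h::real. max 0 (- h) ^ (k + 2) / h) \<longlongrightarrow> 0) (at 0)"
    proof (rule Lim_null_comparison)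
      show "\<forall>\<^sub>F h in at 0. norm (max 0 (- h) ^ (k + 2) / h) \<le> \<bar>h\<bar> ^ (k + 1)"
        by (rule always_eventually) (auto simp: max_def power_abs abs_mult field_simps)
      show "((\<lambda>h::real. \<bar>h\<bar> ^ (k + 1)) \<longlongrightarrow> 0) (at 0)"
        by (auto intro!: tendsto_eq_intros)
    qed
    then show ?thesis using 3 by (simp add: DERIV_def)
  qed
qed

text \<open>\<open>cut i\<close> is the \<open>i\<close>-th derivative of \<open>max 0 (1 - x) ^ 7\<close> for \<open>i \<le> 6\<close>. The exponent is dictated by the
  convergence of the dyadic sum in \<open>alt_sum_majorant\<close>: five differences must beat the fourth power
  of \<open>sum_four_phi_le\<close>, and one more derivative is spent on \<open>alt_sum_Lipschitz\<close>.\<close>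

definition cut :: "nat \<Rightarrow> real \<Rightarrow> real" where
  "cut i x = (\<Prod>j<i. - real (7 - j)) * max 0 (1 - x) ^ (7 - i)"

lemma cut_0: "cut 0 x = max 0 (1 - x) ^ 7"
  by (simp add: cut_def)

lemma cut_deriv: "i < 6 \<Longrightarrow> (cut i has_real_derivative cut (Suc i) x) (at x)"
proof -
  assume i: "i < 6"
  then obtain k where k: "7 - i = k + 2" "7 - Suc i = k + 1" using that[of "5 - i"] by auto
  have eq: "real (7 - i) = real (k + 2)" using k(1) by simp
  then show ?thesis unfolding cut_def k
    by (intro DERIV_cong[OF DERIV_cmult[OF has_real_derivative_pos_part_power]]) (simp add: eq algebra_simps)
qed

text \<open>The largest coefficient is that of \<open>cut 6\<close>, namely 7 * 6 * 5 * 4 * 3 * 2 =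
  5040, and for \<open>x \<ge> 0\<close> the remaining power is at most 1.\<close>

lemma abs_cut_le:
  assumes "i \<le> 6" "x \<ge> 0"
  shows "\<bar>cut i x\<bar> \<le> 5040"
proof -
  have "\<bar>\<Prod>j<i. - real (7 - j)\<bar> \<le> 5040"
  proof -
    have "i \<in> {0,1,2,3,4,5,6}" using assms by auto
    then show ?thesis by (auto simp: eval_nat_numeral)
  qed
  moreover have "\<bar>max 0 (1 - x) ^ (7 - i)\<bar> \<le> 1" using assms by (auto simp: power_abs max_def intro!: power_le_one)
  ultimately have "\<bar>cut i x\<bar> \<le> 5040 * 1" unfolding cut_def abs_mult by (intro mult_mono) auto
  then show ?thesis by simp
qed

section \<open>Logarithmic averages of multiplicative functions\<close>

text \<open>For \<open>j \<ge> 1\<close> this is Jordan's totient of order \<open>t\<close> divided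
  by \<open>j powr t\<close>; for \<open>t = 1\<close> it is Euler's totient of \<open>j\<close>
  over \<open>j\<close>. Its factors are comparable with \<open>min 1 (t * ln p)\<close>, the sizes
  that iterated differences produce.\<close>

definition phi :: "real \<Rightarrow> nat \<Rightarrow> real" where
  "phi t j = (\<Prod>p\<in>prime_factors j. 1 - real p powr (- t))"

text \<open>Multiplied by \<open>k powr t\<close> this says that Jordan's totient summed over the
  divisors of \<open>k\<close> is \<open>k powr t\<close>. The induction isolates one prime power
  \<open>p ^ e\<close> of \<open>k\<close>.\<close>

lemma phi_convolution:
  assumes "k \<ge> 1"
  shows "(\<Sum>d | d dvd k. phi t d * real (k div d) powr (- t)) = 1"
  using assms
proof (induction k rule: less_induct)
  case (less k)
  show ?case
  proof (cases "k = 1")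
    case True
    then show ?thesis by (simp add: phi_def)
  next
    case False
    then obtain p where p: "prime p" "p dvd k" using prime_factor_nat by blast
    define e where "e = multiplicity p k"
    obtain m where m: "k = p ^ e * m" "\<not> p dvd m"
      using less.prems p unfolding e_def by (metis multiplicity_decompose' not_one_le_zero not_prime_unit)
    have e: "e \<ge> 1" using p less.prems unfolding e_def
      by (metis One_nat_def Suc_leI multiplicity_gt_zero_iff not_one_le_zero not_prime_unit)
    define k' where "k' = p ^ (e - 1) * m"
    have kk': "k = p * k'" using m(1) e by (cases e) (simp_all add: k'_def)
    have m0: "m \<ge> 1" using m less.prems by (cases m) auto
    have k'0: "k' \<ge> 1" using kk' less.prems by (cases k') auto
    have p1: "p > 1" using p prime_gt_1_nat by blast
    have cop: "coprime p m" using p m by (simp add: prime_imp_coprime)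
    have k'k: "k' dvd k" using kk' by simp
    have mk: "p ^ e * x dvd k" if "x dvd m" for x using that m(1) by simp
    \<comment> \<open>A divisor either misses the full power \<open>p ^ e\<close>, and then divides
      \<open>k' = k div p\<close>, or it contains it and is \<open>p ^ e\<close> times a divisor of
      \<open>m\<close>. By induction the two families contribute \<open>p powr (- t)\<close> and
      \<open>1 - p powr (- t)\<close>.\<close>
    have sets: "{d. d dvd k} = {d. d dvd k'} \<union> (\<lambda>d. p ^ e * d) ` {d. d dvd m}"
    proof (intro equalityI subsetI)
      fix d assume "d \<in> {d. d dvd k}"
      then have d: "d dvd k" by simp
      then have d0: "d \<noteq> 0" using less.prems by auto
      show "d \<in> {d. d dvd k'} \<union> (\<lambda>d. p ^ e * d) ` {d. d dvd m}"
      proof (cases "p ^ e dvd d")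
        case True
        then obtain d' where "d = p ^ e * d'" by (auto elim: dvdE)
        then show ?thesis using d m p1 by auto
      next
        case False
        obtain d' where d': "d = p ^ multiplicity p d * d'" "\<not> p dvd d'"
          using d0 p by (metis multiplicity_decompose' not_prime_unit)
        have "multiplicity p d < e" using False multiplicity_dvd'[of e p d] by (meson not_le)
        then have "p ^ multiplicity p d dvd p ^ (e - 1)" by (intro le_imp_power_dvd) auto
        moreover have "coprime d' (p ^ e)"
          using d' p by (metis coprime_commute coprime_power_right_iff prime_imp_coprime)
        then have "d' dvd m" using d d' m by (metis coprime_dvd_mult_right_iff dvd_mult_right)
        ultimately have "d dvd k'" unfolding k'_def by (subst d'(1)) (rule mult_dvd_mono)
        then show ?thesis by simp
      qed
    qed (use k'k mk dvd_trans in blast)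
    have disj: "{d. d dvd k'} \<inter> (\<lambda>d. p ^ e * d) ` {d. d dvd m} = {}"
    proof -
      have False if "p ^ e * d dvd k'" for d
      proof -
        have "p ^ (e - 1) * p dvd p ^ (e - 1) * m"
          using that e unfolding k'_def
          by (metis dvd_mult_left power_minus_mult zero_less_one less_le_trans)
        then show False using m p1 by simp
      qed
      then show ?thesis by auto
    qed
    have "(\<Sum>d | d dvd k. phi t d * real (k div d) powr (- t))
       = (\<Sum>d | d dvd k'. phi t d * real (k div d) powr (- t))
         + (\<Sum>d\<in>(\<lambda>d. p ^ e * d) ` {d. d dvd m}. phi t d * real (k div d) powr (- t))"
      unfolding sets using disj k'0 m0 by (intro sum.union_disjoint) (auto intro: finite_divisors_nat)
    also have "(\<Sum>d | d dvd k'. phi t d * real (k div d) powr (- t))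
       = real p powr (- t) * (\<Sum>d | d dvd k'. phi t d * real (k' div d) powr (- t))"
      unfolding sum_distrib_left
      by (intro sum.cong refl) (use k'0 in \<open>auto simp: kk' powr_mult elim!: dvdE\<close>)
    also have "\<dots> = real p powr (- t)" using less.IH[of k'] kk' k'0 p1 by simp
    also have "(\<Sum>d\<in>(\<lambda>d. p ^ e * d) ` {d. d dvd m}. phi t d * real (k div d) powr (- t))
       = (\<Sum>d | d dvd m. phi t (p ^ e * d) * real (k div (p ^ e * d)) powr (- t))"
      using p1 by (subst sum.reindex) (auto simp: inj_on_def)
    also have "\<dots> = (\<Sum>d | d dvd m. (1 - real p powr (- t)) * (phi t d * real (m div d) powr (- t)))"
    proof (intro sum.cong refl)
      fix d assume "d \<in> {d. d dvd m}"
      then have d: "d dvd m" "d \<noteq> 0" using m0 by auto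
      have "\<not> p dvd d" using d m dvd_trans by blast
      then have "p \<notin> prime_factors d" by auto
      moreover have "prime_factors (p ^ e * d) = insert p (prime_factors d)"
        using e d p p1 by (subst prime_factors_product) (auto simp: prime_factorization_prime_power)
      ultimately have "phi t (p ^ e * d) = (1 - real p powr (- t)) * phi t d"
        by (simp add: phi_def)
      moreover have "k div (p ^ e * d) = m div d" using m p1 by simp
      ultimately show "phi t (p ^ e * d) * real (k div (p ^ e * d)) powr (- t)
          = (1 - real p powr (- t)) * (phi t d * real (m div d) powr (- t))" by simp
    qed
    also have "\<dots> = 1 - real p powr (- t)"
    proof -
      have "m < k" using m(1) m0 p1 e
        by (metis One_nat_def mult_less_cancel2 nat_mult_1 one_less_power less_le_trans zero_less_one)
      then show ?thesis using less.IH[of m] m0 by (simp flip: sum_distrib_left)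
    qed
    finally show ?thesis by simp
  qed
qed

lemma phi_nonneg: "t \<ge> 0 \<Longrightarrow> phi t j \<ge> 0"
  unfolding phi_def
  by (intro prod_nonneg) (auto simp: powr_minus field_simps dest!: in_prime_factors_imp_prime prime_ge_1_nat intro!: ge_one_powr_ge_zero)

lemma sum_inverse_le:
  assumes "n \<ge> 1"
  shows "(\<Sum>k=1..n. 1 / real k) \<le> 1 + ln (real n)"
  using assms
proof (induction n rule: nat_induct_at_least)
  case (Suc n)
  have "1 / real (Suc n) \<le> ln (real (Suc n)) - ln (real n)"
    using ln_diff_le[of "real n" "real (Suc n)"] Suc by (simp add: field_simps)
  then show ?case using Suc by simp
qed simp

lemma powr_minus_diff_le:
  assumes "t > 0" "n \<ge> 1"
  shows "real n powr (- t) - real (Suc n) powr (- t) \<le> t * real n powr (- 1 - t)"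
proof -
  have "\<exists>z. real n < z \<and> z < real (Suc n) \<and>
      real (Suc n) powr (- t) - real n powr (- t) = (real (Suc n) - real n) * (- t * z powr (- t - 1))"
    using assms by (intro MVT2) (auto intro!: derivative_eq_intros)
  then obtain z where z: "real n < z" "real (Suc n) powr (- t) - real n powr (- t) = - t * z powr (- t - 1)"
    by auto
  have "z powr (- t - 1) \<le> real n powr (- t - 1)"
    using z assms by (intro powr_mono2') auto
  then have "t * z powr (- t - 1) \<le> t * real n powr (- t - 1)"
    using assms by (intro mult_left_mono) auto
  then show ?thesis using z(2) by (simp add: add.commute minus_diff_commute)
qed

text \<open>Each summand dominates an increment of \<open>(1 - x powr (- t)) / t\<close>, an
  antiderivative of \<open>x powr (- 1 - t)\<close>, and the increments telescope.\<close>

lemma sum_powr_ge: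
  assumes "t > 0"
  shows "(1 - real (Suc n) powr (- t)) / t \<le> (\<Sum>e=1..n. real e powr (- 1 - t))"
proof (induction n)
  case (Suc n)
  have "(1 - real (Suc (Suc n)) powr (- t)) / t
      = (1 - real (Suc n) powr (- t)) / t + (real (Suc n) powr (- t) - real (Suc (Suc n)) powr (- t)) / t"
    by (simp add: diff_divide_distrib)
  also have "\<dots> \<le> (\<Sum>e=1..n. real e powr (- 1 - t)) + real (Suc n) powr (- 1 - t)"
    using Suc powr_minus_diff_le[OF assms, of "Suc n"] assms
    by (intro add_mono) (simp_all add: field_simps)
  finally show ?case by simp
qed simp

text \<open>By \<open>phi_convolution\<close>, multiplying the sum by \<open>\<Sum>e\<le>n. e powr (- 1 - t)\<close>, which is of order \<open>1 / t\<close>,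
  gives at most a harmonic sum; no information on primes is needed.\<close>

lemma sum_phi_le:
  assumes "n \<ge> 2" "t > 0" "t * ln (real n) \<ge> 1"
  shows "(\<Sum>j=1..n. phi t j / real j) \<le> 8 * (t * ln (real n))"
proof -
  have "(\<Sum>j=1..n. phi t j / real j) * (\<Sum>e=1..n. real e powr (- 1 - t))
     = (\<Sum>j=1..n. \<Sum>e=1..n. phi t j * real e powr (- t) / (real j * real e))"
    unfolding sum_product
    by (intro sum.cong refl) (auto simp: powr_diff powr_minus field_simps)
  \<comment> \<open>The square \<open>j, e \<le> n\<close> lies in the region
    \<open>j * e \<le> n^2\<close>. There the terms can be grouped by the product, and
    \<open>phi_convolution\<close> evaluates each group.\<close>
  also have "\<dots> \<le> (\<Sum>j=1..n. \<Sum>e=1..n^2 div j. phi t j * real e powr (- t) / (real j * real e))"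
  proof (intro sum_mono sum_mono2)
    fix j assume j: "j \<in> {1..n}"
    then have "n * j \<le> n ^ 2" by (simp add: power2_eq_square)
    then have "n \<le> n^2 div j" using j by (simp add: less_eq_div_iff_mult_less_eq)
    then show "{1..n} \<subseteq> {1..n^2 div j}" by auto
  qed (use assms in \<open>auto intro!: divide_nonneg_nonneg mult_nonneg_nonneg phi_nonneg\<close>)
  also have "\<dots> \<le> (\<Sum>j=1..n^2. \<Sum>e=1..n^2 div j. phi t j * real e powr (- t) / (real j * real e))"
    using assms by (intro sum_mono2) (auto intro!: sum_nonneg divide_nonneg_nonneg mult_nonneg_nonneg phi_nonneg simp: power2_eq_square intro: order_trans)
  also have "\<dots> = (\<Sum>k=1..n^2. \<Sum>d | d dvd k. phi t d * real (k div d) powr (- t) / (real d * real (k div d)))"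
    by (rule sum_divisors_hyperbola[symmetric])
  also have "\<dots> = (\<Sum>k=1..n^2. (\<Sum>d | d dvd k. phi t d * real (k div d) powr (- t)) / real k)"
    unfolding sum_divide_distrib
    by (intro sum.cong refl) (auto elim!: dvdE)
  also have "\<dots> = (\<Sum>k=1..n^2. 1 / real k)"
    by (intro sum.cong refl) (simp add: phi_convolution)
  also have "\<dots> \<le> 1 + ln (real (n^2))" using assms by (intro sum_inverse_le) (simp add: power2_eq_square)
  also have "\<dots> = 1 + 2 * ln (real n)" using assms by (simp add: ln_realpow)
  also have "\<dots> \<le> 4 * ln (real n)"
  proof -
    have "ln 2 \<le> ln (real n)" using assms by simp
    then show ?thesis using ln2_ge_two_thirds by linarith
  qed
  finally have 1: "(\<Sum>j=1..n. phi t j / real j) * (\<Sum>e=1..n. real e powr (- 1 - t)) \<le> 4 * ln (real n)" .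
  \<comment> \<open>Since \<open>t * ln n \<ge> 1\<close>, the boundary term is at most
    \<open>exp (- 1) \<le> 1 / 2\<close>, and the sum over \<open>e\<close> is at least
    \<open>1 / (2 * t)\<close>.\<close>
  have "real (Suc n) powr (- t) \<le> real n powr (- t)" using assms by (intro powr_mono2') auto
  also have "\<dots> = exp (- (t * ln (real n)))" using assms by (simp add: powr_def)
  also have "\<dots> \<le> exp (- 1)" using assms by simp
  also have "\<dots> \<le> 1 / 2"
    using exp_ge_add_one_self[of 1] by (simp add: exp_minus field_simps)
  finally have "1 / (2 * t) \<le> (1 - real (Suc n) powr (- t)) / t" using assms by (simp add: field_simps)
  also have "\<dots> \<le> (\<Sum>e=1..n. real e powr (- 1 - t))" using assms by (intro sum_powr_ge)
  finally have "(\<Sum>j=1..n. phi t j / real j) * (1 / (2 * t)) \<le> (\<Sum>j=1..n. phi t j / real j) * (\<Sum>e=1..n. real e powr (- 1 - t))"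
    using assms by (intro mult_left_mono sum_nonneg) (auto intro!: divide_nonneg_nonneg phi_nonneg)
  also note 1
  finally show ?thesis using assms by (simp add: field_simps)
qed

text \<open>Each of the 2 ^ card subsets of the prime factors yields a unitary divisor
  \<open>d\<close> whose prime factors and those of \<open>j div d\<close> partition the prime
  factors of \<open>j\<close>, so it contributes the full product of the \<open>x p\<close>. The
  other divisors contribute nonnegative terms.\<close>

lemma unitary_divisor_bound:
  fixes x :: "nat \<Rightarrow> real"
  assumes j: "j \<ge> 1" and x: "\<And>p. x p \<ge> 0"
  shows "(\<Prod>p\<in>prime_factors j. 2 * x p)
    \<le> (\<Sum>d | d dvd j. (\<Prod>p\<in>prime_factors d. x p) * (\<Prod>p\<in>prime_factors (j div d). x p))"
proof -
  \<comment> \<open>\<open>u D\<close> takes the full power of every prime in \<open>D\<close>,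
    which makes it coprime to its cofactor.\<close>
  define u where "u D = (\<Prod>p\<in>D. p ^ multiplicity p j)" for D
  have pf: "prime_factors (u D) = D" and u0: "u D \<noteq> 0" if "D \<subseteq> prime_factors j" for D
  proof -
    have fin: "finite D" using that by (rule finite_subset) simp
    show u0: "u D \<noteq> 0" unfolding u_def using fin that by (auto simp: prod_zero_iff)
    have "prime_factors (p ^ multiplicity p j) = {p}" if "p \<in> D" for p
      using that \<open>D \<subseteq> _\<close> by (subst prime_factorization_prime_power) (auto simp: prime_factors_multiplicity)
    moreover have "prime_factors (u D) = (\<Union>p\<in>D. prime_factors (p ^ multiplicity p j))"
      unfolding u_def using fin that by (subst prime_factors_prod) auto
    ultimately show "prime_factors (u D) = D" by auto
  qed
  have split: "j = u D * u (prime_factors j - D)" if "D \<subseteq> prime_factors j" for D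
  proof -
    have "j = u (prime_factors j)" unfolding u_def using j by (simp add: prod_prime_factors)
    also have "\<dots> = u (prime_factors j - D) * u D" unfolding u_def using that by (intro prod.subset_diff) auto
    finally show ?thesis by (simp add: mult.commute)
  qed
  have "(\<Prod>p\<in>prime_factors j. 2 * x p) = (\<Sum>D\<in>Pow (prime_factors j). (\<Prod>p\<in>prime_factors j. x p))"
    by (simp add: prod.distrib card_Pow)
  also have "\<dots> = (\<Sum>D\<in>Pow (prime_factors j). (\<Prod>p\<in>prime_factors (u D). x p) * (\<Prod>p\<in>prime_factors (j div u D). x p))"
  proof (intro sum.cong refl)
    fix D assume "D \<in> Pow (prime_factors j)"
    then have D: "D \<subseteq> prime_factors j" by simp
    have "j div u D = u (prime_factors j - D)" using split[OF D] u0[OF D] by (metis nonzero_mult_div_cancel_left)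
    then have "prime_factors (j div u D) = prime_factors j - D" using pf[of "prime_factors j - D"] by auto
    then show "(\<Prod>p\<in>prime_factors j. x p) = (\<Prod>p\<in>prime_factors (u D). x p) * (\<Prod>p\<in>prime_factors (j div u D). x p)"
      using D pf[OF D] by (simp add: prod.subset_diff mult.commute)
  qed
  also have "\<dots> = (\<Sum>d\<in>u ` Pow (prime_factors j). (\<Prod>p\<in>prime_factors d. x p) * (\<Prod>p\<in>prime_factors (j div d). x p))"
    by (subst sum.reindex) (auto intro!: inj_on_inverseI[where g = prime_factors] simp: pf)
  also have "\<dots> \<le> (\<Sum>d | d dvd j. (\<Prod>p\<in>prime_factors d. x p) * (\<Prod>p\<in>prime_factors (j div d). x p))"
  proof (rule sum_mono2)
    show "finite {d. d dvd j}" using j by (auto intro: finite_divisors_nat)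
    show "u ` Pow (prime_factors j) \<subseteq> {d. d dvd j}"
      using split by auto (metis dvd_triv_left)
  qed (auto intro!: mult_nonneg_nonneg prod_nonneg x)
  finally show ?thesis .
qed

text \<open>Doubling \<open>x\<close> is dominated by the Dirichlet convolution of the undoubled
  product with itself; extending the hyperbolic region to the square \<open>d, e \<le> n\<close>
  leaves a perfect square.\<close>

lemma sum_prod_double_le:
  fixes x :: "nat \<Rightarrow> real"
  assumes x: "\<And>p. x p \<ge> 0"
  shows "(\<Sum>j=1..n. (\<Prod>p\<in>prime_factors j. 2 * x p) / real j) \<le> (\<Sum>j=1..n. (\<Prod>p\<in>prime_factors j. x p) / real j) ^ 2"
proof -
  define X where "X j = (\<Prod>p\<in>prime_factors j. x p)" for j
  have X: "X j \<ge> 0" for j unfolding X_def by (intro prod_nonneg x)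
  have "(\<Sum>j=1..n. (\<Prod>p\<in>prime_factors j. 2 * x p) / real j) \<le> (\<Sum>j=1..n. (\<Sum>d | d dvd j. X d * X (j div d)) / real j)"
    unfolding X_def by (intro sum_mono divide_right_mono unitary_divisor_bound x) auto
  also have "\<dots> = (\<Sum>j=1..n. (\<Sum>d | d dvd j. (X d / real d) * (X (j div d) / real (j div d))))"
    unfolding sum_divide_distrib by (intro sum.cong refl) (auto elim!: dvdE)
  also have "\<dots> = (\<Sum>d=1..n. \<Sum>e=1..n div d. (X d / real d) * (X e / real e))"
    by (rule sum_divisors_hyperbola)
  also have "\<dots> \<le> (\<Sum>d=1..n. \<Sum>e=1..n. (X d / real d) * (X e / real e))"
    by (intro sum_mono sum_mono2) (auto intro!: mult_nonneg_nonneg divide_nonneg_nonneg X intro: order_trans)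
  also have "\<dots> = (\<Sum>j=1..n. X j / real j) ^ 2"
    by (simp add: power2_eq_square sum_product)
  finally show ?thesis by (simp add: X_def)
qed

text \<open>The factor 4 is two doublings, each of which squares the bound of
  \<open>sum_phi_le\<close>.\<close>

lemma sum_four_phi_le:
  assumes "n \<ge> 2" "t > 0" "t * ln (real n) \<ge> 1"
  shows "(\<Sum>j=1..n. (\<Prod>p\<in>prime_factors j. 4 * (1 - real p powr (- t))) / real j) \<le> (8 * (t * ln (real n))) ^ 4"
proof -
  \<comment> \<open>Clamping at 0 provides nonnegativity at every index, as
    \<open>sum_prod_double_le\<close> demands, and changes nothing at primes.\<close>
  define y where "y p = max 0 (1 - real p powr (- t))" for p :: nat
  have y: "1 - real p powr (- t) = y p" if "p \<in> prime_factors j" for p j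
    using that assms by (auto simp: y_def max_def powr_minus field_simps dest!: in_prime_factors_imp_prime prime_ge_1_nat
      intro!: ge_one_powr_ge_zero)
  have y0: "y p \<ge> 0" for p by (simp add: y_def)
  have "(\<Sum>j=1..n. (\<Prod>p\<in>prime_factors j. 4 * (1 - real p powr (- t))) / real j)
     = (\<Sum>j=1..n. (\<Prod>p\<in>prime_factors j. 2 * (2 * y p)) / real j)"
    by (intro sum.cong refl arg_cong2[of _ _ _ _ "(/)"] prod.cong) (auto simp: y)
  also have "\<dots> \<le> (\<Sum>j=1..n. (\<Prod>p\<in>prime_factors j. 2 * y p) / real j) ^ 2"
    by (rule sum_prod_double_le) (simp add: y0)
  also have "\<dots> \<le> ((\<Sum>j=1..n. (\<Prod>p\<in>prime_factors j. y p) / real j) ^ 2) ^ 2"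
    by (intro power_mono sum_prod_double_le sum_nonneg divide_nonneg_nonneg prod_nonneg) (auto simp: y0)
  also have "(\<Sum>j=1..n. (\<Prod>p\<in>prime_factors j. y p) / real j) = (\<Sum>j=1..n. phi t j / real j)"
    unfolding phi_def by (intro sum.cong refl arg_cong2[of _ _ _ _ "(/)"] prod.cong) (auto simp: y)
  also have "(\<dots> ^ 2) ^ 2 \<le> ((8 * (t * ln (real n))) ^ 2) ^ 2"
    using assms by (intro power_mono sum_phi_le) (auto intro!: sum_nonneg divide_nonneg_nonneg phi_nonneg)
  finally show ?thesis by simp
qed

section \<open>Sieve weights\<close>

text \<open>\<open>Q\<close> consists of \<open>K\<close> smallest elements and \<open>2 ^ - k\<close> is the dyadic size of the largest of
  them, so that beyond \<open>Q\<close> the factors \<open>min 1 (2 ^ k * a p)\<close> are 1.\<close>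

lemma dyadic_selection:
  fixes a :: "'a \<Rightarrow> real"
  assumes "finite P" and a: "\<And>p. p \<in> P \<Longrightarrow> a p \<ge> 0" and I: "\<And>p. p \<in> P \<Longrightarrow> 2 ^ I * a p \<ge> 1"
  obtains k Q where "k \<le> I" "Q \<subseteq> P" "card Q \<le> K"
    "prod a Q \<le> (2 / 2 ^ k) ^ K * (\<Prod>p\<in>P. min 1 (2 ^ k * a p))"
proof -
  \<comment> \<open>\<open>V k\<close> holds the elements below \<open>2 ^ - k\<close> and shrinks
    as \<open>k\<close> grows. The scale chosen is the first one at which at most \<open>K\<close>
    elements remain.\<close>
  define V where "V k = {p \<in> P. 2 ^ k * a p < 1}" for k :: nat
  have VI: "V I = {}" using I by (auto simp: V_def not_less)
  define k where "k = (LEAST k. card (V k) \<le> K)"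
  have kK: "card (V k) \<le> K" unfolding k_def by (rule LeastI[of _ I]) (simp add: VI)
  have kI: "k \<le> I" unfolding k_def by (rule Least_le) (simp add: VI)
  have fin: "finite (V i)" for i using assms(1) by (simp add: V_def)
  have rest: "(\<Prod>p\<in>Q. min 1 (2 ^ k * a p)) = (\<Prod>p\<in>P. min 1 (2 ^ k * a p))"
    if "V k \<subseteq> Q" "Q \<subseteq> P" for Q
    using that assms(1) by (intro prod.mono_neutral_left) (auto simp: V_def not_less)
  have nonneg: "(\<Prod>p\<in>P. min 1 (2 ^ k * a p)) \<ge> 0" using a by (intro prod_nonneg) auto
  show thesis
  proof (cases k)
    case 0
    have "prod a (V k) = (\<Prod>p\<in>P. min 1 (2 ^ k * a p))"
      by (subst rest[symmetric, of "V k"]) (auto simp: V_def 0 intro!: prod.cong)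
    also have "\<dots> \<le> 2 ^ K * (\<Prod>p\<in>P. min 1 (2 ^ k * a p))"
      using nonneg by (simp add: mult_le_cancel_right1)
    finally show thesis using kI kK by (intro that[of k "V k"]) (auto simp: 0 V_def)
  next
    case (Suc k')
    have "\<not> card (V k') \<le> K" using not_less_Least[of k' "\<lambda>k. card (V k) \<le> K"] Suc by (simp add: k_def)
    moreover have "V k \<subseteq> V k'"
    proof
      fix p assume "p \<in> V k"
      then have p: "p \<in> P" "2 ^ k * a p < 1" by (auto simp: V_def)
      have "2 ^ k' * a p \<le> 2 ^ k * a p" using a p Suc by (intro mult_right_mono) auto
      then show "p \<in> V k'" using p by (simp add: V_def)
    qed
    \<comment> \<open>By minimality more than \<open>K\<close> elements lie in \<open>V k'\<close>,
      so exactly \<open>K\<close> can be chosen between \<open>V k\<close> and \<open>V k'\<close>.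
      Each chosen \<open>a p\<close> is below \<open>2 / 2 ^ k\<close>.\<close>
    ultimately obtain Q where Q: "V k \<subseteq> Q" "Q \<subseteq> V k'" "card Q = K"
      using exists_subset_between[of "V k" K "V k'"] kK fin by auto
    then have QP: "Q \<subseteq> P" by (auto simp: V_def)
    have "prod a Q \<le> (\<Prod>p\<in>Q. 2 / 2 ^ k * min 1 (2 ^ k * a p))"
    proof (intro prod_mono conjI)
      fix p assume "p \<in> Q"
      then have p: "p \<in> P" "2 ^ k' * a p < 1" using Q QP by (auto simp: V_def)
      then show "0 \<le> a p" using a by simp
      show "a p \<le> 2 / 2 ^ k * min 1 (2 ^ k * a p)"
        using p a[of p] Suc by (auto simp: min_def field_simps)
    qed
    also have "\<dots> = (2 / 2 ^ k) ^ K * (\<Prod>p\<in>P. min 1 (2 ^ k * a p))"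
      unfolding rest[OF Q(1) QP, symmetric] Q(3)[symmetric] by (simp only: prod.distrib prod_constant)
    finally show thesis using kI Q QP by (intro that[of k Q]) auto
  qed
qed

text \<open>For \<open>i = 0\<close> and \<open>x = r * ln m\<close> this is the sieve weight
  attached to \<open>j\<close>, the sum of \<open>mob d * cut 0 (r * ln (d * m))\<close> over the
  divisors \<open>d\<close> of \<open>j\<close>; the case \<open>i = 1\<close> is its derivative in
  \<open>x\<close>. The sum over prime sets is the form to which
  \<open>alternating_difference_bound\<close> applies.\<close>

definition alt_sum :: "real \<Rightarrow> nat \<Rightarrow> real \<Rightarrow> nat \<Rightarrow> real" where
  "alt_sum r i x j = (\<Sum>D\<in>Pow (prime_factors j). (- 1) ^ card D * cut i (x + (\<Sum>p\<in>D. r * ln (real p))))"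

lemma ln_prime_ge: "p \<in> prime_factors j \<Longrightarrow> ln (real p) \<ge> ln 2"
  by (auto dest!: in_prime_factors_imp_prime prime_ge_2_nat)

lemma ln_prime_nonneg: "p \<in> prime_factors j \<Longrightarrow> ln (real p) \<ge> 0"
  using ln_prime_ge[of p j] ln2_ge_two_thirds by linarith

text \<open>Five of the smallest prime factors are traded for derivatives, so the order
  \<open>i + 5\<close> stays at most 6; the constant is 5040 * 2 ^ 5. The scale \<open>k\<close>
  depends on \<open>j\<close>, and summing over all scales removes this dependence.\<close>

lemma alt_sum_bound:
  assumes r: "0 \<le> r" "r \<le> R" "1 \<le> 2 ^ I * (R * ln 2)" and i: "i \<le> 1" "x \<ge> 0"
  shows "\<bar>alt_sum r i x j\<bar>
    \<le> 161280 * (\<Sum>k\<le>I. (1 / 2 ^ k) ^ 5 * (\<Prod>p\<in>prime_factors j. 2 * min 1 (2 ^ k * R * ln (real p))))"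
proof -
  let ?P = "prime_factors j"
  have R: "R \<ge> 0" using r by linarith
  have ln0: "ln (real p) \<ge> 0" if "p \<in> ?P" for p using ln_prime_nonneg that by blast
  obtain k Q where kQ: "k \<le> I" "Q \<subseteq> ?P" "card Q \<le> 5"
    "(\<Prod>p\<in>Q. R * ln (real p)) \<le> (2 / 2 ^ k) ^ 5 * (\<Prod>p\<in>?P. min 1 (2 ^ k * (R * ln (real p))))"
  \<comment> \<open>The selection uses \<open>R\<close> instead of \<open>r\<close>, so one bound
    serves all \<open>r \<le> R\<close>.\<close>
  proof (rule dyadic_selection[of ?P "\<lambda>p. R * ln (real p)" I 5])
    fix p assume p: "p \<in> ?P"
    have "2 ^ I * (R * ln 2) \<le> 2 ^ I * (R * ln (real p))"
      using R ln_prime_ge[OF p] by (intro mult_left_mono) auto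
    then show "1 \<le> 2 ^ I * (R * ln (real p))" using r by linarith
  qed (use R ln0 in auto)
  let ?m = "\<lambda>k. (\<Prod>p\<in>?P. min 1 (2 ^ k * R * ln (real p)))"
  have m0: "?m k \<ge> 0" for k using R ln0 by (intro prod_nonneg) auto
  have "\<bar>alt_sum r i x j\<bar> \<le> 2 ^ (card ?P - card Q) * 5040 * (\<Prod>p\<in>Q. r * ln (real p))"
    unfolding alt_sum_def
    using kQ i r ln0 by (intro alternating_difference_bound[where K = 6] cut_deriv abs_cut_le) auto
  also have "\<dots> \<le> 2 ^ card ?P * 5040 * (\<Prod>p\<in>Q. R * ln (real p))"
    using r ln0 kQ(2) R
    by (intro mult_mono prod_mono power_increasing) (auto intro!: mult_right_mono mult_nonneg_nonneg prod_nonneg)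
  also have "\<dots> \<le> 2 ^ card ?P * 5040 * ((2 / 2 ^ k) ^ 5 * ?m k)"
    using kQ(4) by (intro mult_left_mono) (auto simp: mult.assoc)
  also have "\<dots> = 161280 * ((1 / 2 ^ k) ^ 5 * (2 ^ card ?P * ?m k))"
    by (simp add: power_divide)
  also have "2 ^ card ?P * ?m k = (\<Prod>p\<in>?P. 2 * min 1 (2 ^ k * R * ln (real p)))"
    by (simp add: prod.distrib)
  also have "161280 * ((1 / 2 ^ k) ^ 5 * \<dots>)
     \<le> 161280 * (\<Sum>k\<le>I. (1 / 2 ^ k) ^ 5 * (\<Prod>p\<in>?P. 2 * min 1 (2 ^ k * R * ln (real p))))"
    using kQ(1) R ln0
    by (intro mult_left_mono member_le_sum[where f = "\<lambda>k. (1 / 2 ^ k) ^ 5 * (\<Prod>p\<in>?P. 2 * min 1 (2 ^ k * R * ln (real p)))"])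
       (auto intro!: mult_nonneg_nonneg prod_nonneg)
  finally show ?thesis .
qed

text \<open>With \<open>y = t * ln p\<close> this is
  \<open>min 1 y \<le> 2 * (1 - exp (- y))\<close>, a consequence of
  \<open>exp (- y) \<le> 1 / (1 + y)\<close>. It links the dyadic factors with those of
  \<open>phi\<close>.\<close>

lemma two_min_le:
  assumes "p \<ge> 1" "t \<ge> 0"
  shows "2 * min 1 (t * ln (real p)) \<le> 4 * (1 - real p powr (- t))"
proof -
  define y where "y = t * ln (real p)"
  have y: "y \<ge> 0" using assms by (simp add: y_def)
  have e: "exp (- y) * (1 + y) \<le> 1"
    using mult_left_mono[OF exp_ge_add_one_self[of y], of "exp (- y)"] by (simp add: exp_minus field_simps)
  have "min 1 y \<le> 2 * (1 - exp (- y))"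
  proof (cases "y \<le> 1")
    case True
    have "exp (- y) \<le> 1 / (1 + y)" using e y by (simp add: field_simps)
    also have "\<dots> \<le> 1 - y / 2" using True y by (simp add: field_simps power2_eq_square mult_left_le)
    finally show ?thesis using True by (simp add: min_def)
  next
    case False
    have "exp (- y) * 2 \<le> exp (- y) * (1 + y)" using False by (intro mult_left_mono) auto
    also note e
    finally show ?thesis using False by (simp add: min_def)
  qed
  then show ?thesis using assms by (simp add: y_def powr_def)
qed


lemma alt_sum_Lipschitz:
  assumes B: "\<And>x. x \<ge> 0 \<Longrightarrow> \<bar>alt_sum r 1 x j\<bar> \<le> B" and x: "x \<ge> 0" "a \<ge> 0"
  shows "\<bar>alt_sum r 0 x j - alt_sum r 0 (x + a) j\<bar> \<le> a * B"
proof (cases "a = 0")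
  case False
  have d: "((\<lambda>x. alt_sum r 0 x j) has_real_derivative alt_sum r 1 y j) (at y)" for y
    unfolding alt_sum_def
    by (auto intro!: derivative_eq_intros DERIV_chain'[OF _ cut_deriv] simp: mult.commute)
  have "x < x + a" using False x by simp
  from MVT2[OF this d] obtain z where z: "x < z" "alt_sum r 0 (x + a) j - alt_sum r 0 x j = a * alt_sum r 1 z j" by auto
  then have "\<bar>alt_sum r 0 x j - alt_sum r 0 (x + a) j\<bar> = a * \<bar>alt_sum r 1 z j\<bar>"
    using x by (metis abs_minus_commute abs_mult abs_of_nonneg)
  also have "\<dots> \<le> a * B" using z x by (intro mult_left_mono B) auto
  finally show ?thesis .
qed simp

text \<open>At scale \<open>k\<close> the logarithmic average is at most
  \<open>(128 * 2 ^ k) ^ 4\<close>, and the factor \<open>(1 / 2 ^ k) ^ 5\<close> leaves a geometric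
  series. The same \<open>B\<close> serves all \<open>r\<close>, \<open>i\<close> and
  \<open>x\<close>, and \<open>C\<close> does not depend on \<open>n\<close>.\<close>

lemma alt_sum_majorant:
  obtains C :: real where "C > 0"
    "\<And>n. n \<ge> 2 \<Longrightarrow> \<exists>B. (\<forall>j. B j \<ge> 0) \<and> (\<Sum>j=1..n. B j / real j) \<le> C \<and>
       (\<forall>r i x j. 0 \<le> r \<longrightarrow> r \<le> 16 / ln (real n) \<longrightarrow> i \<le> 1 \<longrightarrow> x \<ge> 0 \<longrightarrow> \<bar>alt_sum r i x j\<bar> \<le> B j)"
proof
  let ?C = "161280 * (128 ^ 4 * 2) :: real"
  show "?C > 0" by simp
  fix n :: nat assume n: "n \<ge> 2"
  \<comment> \<open>This makes \<open>2 ^ k * R * ln n\<close> equal to \<open>16 * 2 ^ k\<close>,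
    whence the hypothesis of \<open>sum_four_phi_le\<close> at every scale and the constant 128 = 8
    * 16.\<close>
  define R where "R = 16 / ln (real n)"
  have ln0: "ln (real n) > 0" using n by simp
  have R: "R > 0" using ln0 by (simp add: R_def)
  obtain I where I: "1 / (R * ln 2) < 2 ^ I"
    using real_arch_pow[of 2 "1 / (R * ln 2)"] by auto
  have I: "1 \<le> 2 ^ I * (R * ln 2)" using I R by (simp add: field_simps)
  define w where "w k j = (\<Prod>p\<in>prime_factors j. 2 * min 1 (2 ^ k * R * ln (real p)))" for k j :: nat
  define B where "B j = 161280 * (\<Sum>k\<le>I. (1 / 2 ^ k) ^ 5 * w k j)" for j
  have w0: "w k j \<ge> 0" for k j
    unfolding w_def using R by (intro prod_nonneg) (auto intro!: mult_nonneg_nonneg dest: ln_prime_nonneg)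
  have W: "(\<Sum>j=1..n. w k j / real j) \<le> 128 ^ 4 * (2 ^ k) ^ 4" for k
  proof -
    let ?t = "2 ^ k * R"
    have "(\<Sum>j=1..n. w k j / real j) \<le> (\<Sum>j=1..n. (\<Prod>p\<in>prime_factors j. 4 * (1 - real p powr (- ?t))) / real j)"
      unfolding w_def
    proof (intro sum_mono divide_right_mono prod_mono conjI)
      fix p j :: nat assume p: "p \<in> prime_factors j"
      then have "p \<ge> 1" using in_prime_factors_imp_prime prime_ge_1_nat by blast
      then show "2 * min 1 (?t * ln (real p)) \<le> 4 * (1 - real p powr (- ?t))"
        using R by (intro two_min_le) auto
      show "0 \<le> 2 * min 1 (?t * ln (real p))" using R ln_prime_nonneg[OF p] by simp
    qed simp
    also have "\<dots> \<le> (8 * (?t * ln (real n))) ^ 4"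
    proof (rule sum_four_phi_le)
      have "?t * ln (real n) = 2 ^ k * 16" using ln0 by (simp add: R_def)
      also have "\<dots> \<ge> 1 * 1" by (intro mult_mono) auto
      finally show "1 \<le> ?t * ln (real n)" by simp
    qed (use n R in auto)
    also have "8 * (?t * ln (real n)) = 128 * 2 ^ k" using ln0 by (simp add: R_def)
    finally show ?thesis by (simp add: power_mult_distrib)
  qed
  have "(\<Sum>j=1..n. B j / real j) = 161280 * (\<Sum>k\<le>I. (1 / 2 ^ k) ^ 5 * (\<Sum>j=1..n. w k j / real j))"
  proof -
    have "(\<Sum>j=1..n. B j / real j) = (\<Sum>j=1..n. \<Sum>k\<le>I. 161280 * ((1 / 2 ^ k) ^ 5 * (w k j / real j)))"
      unfolding B_def by (simp add: sum_distrib_left sum_divide_distrib)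
    also have "\<dots> = (\<Sum>k\<le>I. \<Sum>j=1..n. 161280 * ((1 / 2 ^ k) ^ 5 * (w k j / real j)))" by (rule sum.swap)
    finally show ?thesis by (simp add: sum_distrib_left)
  qed
  also have "\<dots> \<le> 161280 * (\<Sum>k\<le>I. (1 / 2 ^ k) ^ 5 * (128 ^ 4 * (2 ^ k) ^ 4))"
    by (intro mult_left_mono sum_mono W) auto
  also have "(\<Sum>k\<le>I. (1 / 2 ^ k) ^ 5 * (128 ^ 4 * (2 ^ k) ^ 4)) = 128 ^ 4 * (\<Sum>k\<le>I. (1 / 2 :: real) ^ k)"
    unfolding sum_distrib_left by (intro sum.cong refl) (simp add: eval_nat_numeral field_simps)
  also have "(\<Sum>k\<le>I. (1 / 2 :: real) ^ k) \<le> 2"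
    using sum_gp_basic[of "1 / 2 :: real" I] by simp
  finally have sumB: "(\<Sum>j=1..n. B j / real j) \<le> ?C" by simp
  have "\<bar>alt_sum r i x j\<bar> \<le> B j" if "0 \<le> r" "r \<le> R" "i \<le> 1" "x \<ge> 0" for r i x j
    unfolding B_def w_def using that I by (intro alt_sum_bound)
  moreover have "B j \<ge> 0" for j
    unfolding B_def by (intro mult_nonneg_nonneg sum_nonneg) (auto simp: w0)
  ultimately show "\<exists>B. (\<forall>j. B j \<ge> 0) \<and> (\<Sum>j=1..n. B j / real j) \<le> ?C \<and>
       (\<forall>r i x j. 0 \<le> r \<longrightarrow> r \<le> 16 / ln (real n) \<longrightarrow> i \<le> 1 \<longrightarrow> x \<ge> 0 \<longrightarrow> \<bar>alt_sum r i x j\<bar> \<le> B j)"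
    using sumB unfolding R_def by (intro exI[of _ B]) blast
qed

section \<open>Weighted sums and truncation\<close>

lemma sum_by_parts:
  fixes s L :: "nat \<Rightarrow> 'a::comm_ring"
  shows "(\<Sum>m=1..n. s m * L m) = (\<Sum>m=1..n. (\<Sum>i=1..m. s i) * (L m - L (Suc m))) + (\<Sum>i=1..n. s i) * L (Suc n)"
  by (induction n) (auto simp: algebra_simps)

text \<open>Replace \<open>b\<close> by the convolution of \<open>mob\<close> with its divisor sum
  \<open>s\<close> and put the variable \<open>m\<close> of \<open>s\<close> outermost. The factor
  \<open>n div m div d\<close> counts the multiples \<open>j\<close> of \<open>d\<close> up to
  \<open>n div m\<close>, and collecting \<open>d\<close> by \<open>j\<close> gives the sieve
  weights.\<close>

lemma weighted_sum_kernel: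
  fixes b :: "nat \<Rightarrow> complex" and r :: real
  defines "s \<equiv> \<lambda>m. \<Sum>k | k dvd m. b k"
  shows "(\<Sum>k=1..n. b k * of_real (cut 0 (r * ln (real k))) * of_nat (n div k))
     = (\<Sum>m=1..n. s m * of_real (\<Sum>j=1..n div m. alt_sum r 0 (r * ln (real m)) j))"
proof -
  define w where "w k = cut 0 (r * ln (real k))" for k :: nat
  have "(\<Sum>k=1..n. b k * of_real (w k) * of_nat (n div k))
      = (\<Sum>k=1..n. \<Sum>d | d dvd k. of_real (mob d) * s (k div d) * of_real (w k) * of_nat (n div k))"
    unfolding s_def sum_distrib_right[symmetric]
    by (intro sum.cong refl) (simp add: mob_inversion)
  also have "\<dots> = (\<Sum>k=1..n. \<Sum>d | d dvd k. of_real (mob d) * s (k div d) * of_real (w (d * (k div d))) * of_nat (n div d div (k div d)))"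
    by (intro sum.cong refl) (auto simp: div_mult2_eq[symmetric])
  also have "\<dots> = (\<Sum>d=1..n. \<Sum>m=1..n div d. of_real (mob d) * s m * of_real (w (d * m)) * of_nat (n div d div m))"
    by (rule sum_divisors_hyperbola)
  also have "\<dots> = (\<Sum>m=1..n. \<Sum>d=1..n div m. of_real (mob d) * s m * of_real (w (d * m)) * of_nat (n div d div m))"
    by (rule sum_atMost_div_swap)
  also have "\<dots> = (\<Sum>m=1..n. s m * of_real (\<Sum>d=1..n div m. mob d * w (d * m) * of_nat (n div m div d)))"
    unfolding of_real_sum sum_distrib_left
    by (intro sum.cong refl) (simp add: div_mult2_eq[symmetric] mult_ac)
  also have "\<dots> = (\<Sum>m=1..n. s m * of_real (\<Sum>j=1..n div m. alt_sum r 0 (r * ln (real m)) j))"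
  proof (rule sum.cong[OF refl])
    fix m assume m: "m \<in> {1..n}"
    have "(\<Sum>d=1..n div m. mob d * w (d * m) * of_nat (n div m div d)) = (\<Sum>j=1..n div m. \<Sum>d | d dvd j. mob d * w (d * m))"
      by (rule sum_sum_divisors[symmetric])
    also have "\<dots> = (\<Sum>j=1..n div m. alt_sum r 0 (r * ln (real m)) j)"
    proof (intro sum.cong refl)
      fix j assume "j \<in> {1..n div m}"
      then have "(\<Sum>d | d dvd j. mob d * w (d * m)) = (\<Sum>D\<in>Pow (prime_factors j). (- 1) ^ card D * w (\<Prod>D * m))"
        by (intro sum_mob_divisors) auto
      also have "\<dots> = alt_sum r 0 (r * ln (real m)) j"
        unfolding alt_sum_def w_def
      proof (intro sum.cong refl arg_cong2[of _ _ _ _ "(*)"] arg_cong[of _ _ "cut 0"])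
        fix D assume D: "D \<in> Pow (prime_factors j)"
        then have fin: "finite D" by (auto intro: finite_subset)
        have pos: "p > 0" if "p \<in> D" for p
          using that D by (auto dest!: in_prime_factors_imp_prime intro: prime_gt_0_nat)
        have "ln (real (\<Prod>D)) = (\<Sum>p\<in>D. ln (real p))"
          using fin pos by (simp add: of_nat_prod ln_prod)
        moreover have "real (\<Prod>D) > 0" using pos fin by (simp add: prod_pos del: of_nat_prod)
        ultimately show "r * ln (real (\<Prod>D * m)) = r * ln (real m) + (\<Sum>p\<in>D. r * ln (real p))"
          using m by (simp add: ln_mult sum_distrib_left[symmetric] algebra_simps del: of_nat_prod)
      qed
      finally show "(\<Sum>d | d dvd j. mob d * w (d * m)) = alt_sum r 0 (r * ln (real m)) j" .
    qed
    finally show "s m * of_real (\<Sum>d=1..n div m. mob d * w (d * m) * of_nat (n div m div d))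
        = s m * of_real (\<Sum>j=1..n div m. alt_sum r 0 (r * ln (real m)) j)" by (rule arg_cong)
  qed
  finally show ?thesis by (simp add: w_def)
qed

lemma sum_div_le:
  fixes B :: "nat \<Rightarrow> real"
  assumes "\<And>j. B j \<ge> 0"
  shows "(\<Sum>m=1..n. \<Sum>j=1..n div m. B j) \<le> real n * (\<Sum>j=1..n. B j / real j)"
proof -
  have "(\<Sum>m=1..n. \<Sum>j=1..n div m. B j) = (\<Sum>j=1..n. \<Sum>m=1..n div j. B j)"
    by (rule sum_atMost_div_swap)
  also have "\<dots> = (\<Sum>j=1..n. B j * real (n div j))" by (simp add: mult.commute)
  also have "\<dots> \<le> (\<Sum>j=1..n. B j * (real n / real j))"
    by (intro sum_mono mult_left_mono of_nat_div_le_of_nat assms)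
  finally show ?thesis by (simp add: sum_distrib_left mult_ac)
qed

text \<open>Partial summation in the kernel formula. The kernel \<open>L m\<close> changes with
  \<open>m\<close> through the range \<open>n div m\<close>, which costs a decrement of
  \<open>T\<close>, and through the argument \<open>r * ln m\<close>, which costs
  \<open>r / m * T m\<close> by the Lipschitz bound.\<close>

lemma weighted_sum_bound:
  fixes b :: "nat \<Rightarrow> complex"
  assumes n: "n \<ge> 2" and r: "r \<ge> 0"
    and B0: "\<And>j. B j \<ge> 0" and Bsum: "(\<Sum>j=1..n. B j / real j) \<le> C"
    and B: "\<And>i x j. i \<le> 1 \<Longrightarrow> x \<ge> 0 \<Longrightarrow> \<bar>alt_sum r i x j\<bar> \<le> B j"
    and S: "\<And>m. 1 \<le> m \<Longrightarrow> m \<le> n \<Longrightarrow> cmod (\<Sum>k=1..m. b k * of_nat (m div k)) \<le> E * real m + F"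
    and EF: "E \<ge> 0" "F \<ge> 0"
  shows "cmod (\<Sum>k=1..n. b k * of_real (cut 0 (r * ln (real k))) * of_nat (n div k)) \<le> (E + F) * (1 + r) * real n * C"
proof -
  define s where "s m = (\<Sum>k | k dvd m. b k)" for m
  define L where "L m = (\<Sum>j=1..n div m. alt_sum r 0 (r * ln (real m)) j)" for m
  define T where "T m = (\<Sum>j=1..n div m. B j)" for m
  have Sn: "(\<Sum>i=1..m. s i) = (\<Sum>k=1..m. b k * of_nat (m div k))" for m
    unfolding s_def by (rule sum_sum_divisors)
  \<comment> \<open>\<open>n div Suc n = 0\<close> empties both sums, so partial summation has no
    boundary term.\<close>
  have LS: "L (Suc n) = 0" and TS: "T (Suc n) = 0" by (simp_all add: L_def T_def)
  have T0: "T m \<ge> 0" for m unfolding T_def by (intro sum_nonneg B0)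
  have Tmono: "T (Suc m) \<le> T m" if "m \<ge> 1" for m
    unfolding T_def using that by (intro sum_mono2 B0) (auto intro: order_trans div_le_mono2)
  have dL: "\<bar>L m - L (Suc m)\<bar> \<le> (T m - T (Suc m)) + r / real m * T m" if "m \<ge> 1" for m
  proof -
    let ?x = "r * ln (real m)" and ?y = "r * ln (real (Suc m))"
    have le: "n div Suc m \<le> n div m" using that by (intro div_le_mono2) auto
    have spl: "(\<Sum>j=1..n div m. f j) = (\<Sum>j=1..n div Suc m. f j) + (\<Sum>j=Suc (n div Suc m)..n div m. f j)" for f :: "nat \<Rightarrow> real"
      using sum.ub_add_nat[of 1 "n div Suc m" f "n div m - n div Suc m"] le by simp
    have x0: "?x \<ge> 0" using that r by simp
    have a: "0 \<le> ?y - ?x" "?y - ?x \<le> r / real m"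
    proof -
      have "ln (real m) \<le> ln (real (Suc m))" using that by simp
      then show "0 \<le> ?y - ?x" using r mult_left_mono[of "ln (real m)" "ln (real (Suc m))" r] by simp
      have "ln (real (Suc m)) - ln (real m) \<le> 1 / real m"
        using ln_diff_le[of "real (Suc m)" "real m"] that by simp
      then have "r * (ln (real (Suc m)) - ln (real m)) \<le> r * (1 / real m)" using r by (intro mult_left_mono)
      then show "?y - ?x \<le> r / real m" by (simp add: algebra_simps)
    qed
    have eq: "L m - L (Suc m) = (\<Sum>j=Suc (n div Suc m)..n div m. alt_sum r 0 ?x j)
        + (\<Sum>j=1..n div Suc m. alt_sum r 0 ?x j - alt_sum r 0 ?y j)"
      unfolding L_def by (subst spl) (simp add: sum_subtractf)
    have "\<bar>L m - L (Suc m)\<bar> \<le> (\<Sum>j=Suc (n div Suc m)..n div m. \<bar>alt_sum r 0 ?x j\<bar>)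
        + (\<Sum>j=1..n div Suc m. \<bar>alt_sum r 0 ?x j - alt_sum r 0 ?y j\<bar>)"
      unfolding eq by (rule order_trans[OF abs_triangle_ineq add_mono[OF sum_abs sum_abs]])
    also have "\<dots> \<le> (\<Sum>j=Suc (n div Suc m)..n div m. B j) + (\<Sum>j=1..n div Suc m. r / real m * B j)"
    proof (intro add_mono sum_mono)
      fix j
      show "\<bar>alt_sum r 0 ?x j\<bar> \<le> B j" using x0 by (intro B) auto
      have "\<bar>alt_sum r 0 ?x j - alt_sum r 0 (?x + (?y - ?x)) j\<bar> \<le> (?y - ?x) * B j"
        using x0 a by (intro alt_sum_Lipschitz B) auto
      also have "\<dots> \<le> r / real m * B j" using a B0 by (intro mult_right_mono) auto
      finally show "\<bar>alt_sum r 0 ?x j - alt_sum r 0 ?y j\<bar> \<le> r / real m * B j" by simp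
    qed
    also have "\<dots> = (T m - T (Suc m)) + r / real m * T (Suc m)"
      unfolding T_def by (subst spl) (simp add: sum_distrib_left)
    also have "\<dots> \<le> (T m - T (Suc m)) + r / real m * T m"
      using Tmono[OF that] r by (intro add_left_mono mult_left_mono) auto
    finally show ?thesis .
  qed
  have Tsum: "(\<Sum>m=1..n. T m) \<le> real n * C"
    unfolding T_def using order_trans[OF sum_div_le mult_left_mono[OF Bsum]] B0 by simp
  \<comment> \<open>Partial summation of the constant 1, read backwards, turns the weighted
    decrements back into the sum of \<open>T\<close>.\<close>
  have parts: "(\<Sum>m=1..n. real m * (T m - T (Suc m))) = (\<Sum>m=1..n. T m)"
    using sum_by_parts[of "\<lambda>_. 1" T n] TS by simp
  have "(\<Sum>k=1..n. b k * of_real (cut 0 (r * ln (real k))) * of_nat (n div k)) = (\<Sum>m=1..n. s m * of_real (L m))"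
    unfolding s_def L_def by (rule weighted_sum_kernel)
  also have "\<dots> = (\<Sum>m=1..n. (\<Sum>i=1..m. s i) * of_real (L m - L (Suc m)))"
    using sum_by_parts[of s "\<lambda>m. of_real (L m)" n] LS by simp
  also have "cmod \<dots> \<le> (\<Sum>m=1..n. cmod (\<Sum>i=1..m. s i) * \<bar>L m - L (Suc m)\<bar>)"
    by (rule order_trans[OF norm_sum]) (simp add: norm_mult flip: of_real_diff)
  also have "\<dots> \<le> (\<Sum>m=1..n. ((E + F) * real m) * ((T m - T (Suc m)) + r / real m * T m))"
  proof (intro sum_mono mult_mono)
    fix m assume m: "m \<in> {1..n}"
    have "cmod (\<Sum>i=1..m. s i) \<le> E * real m + F * 1" unfolding Sn using S m by simp
    also have "\<dots> \<le> E * real m + F * real m" using m EF by (intro add_left_mono mult_left_mono) auto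
    finally show "cmod (\<Sum>i=1..m. s i) \<le> (E + F) * real m" by (simp add: algebra_simps)
    show "\<bar>L m - L (Suc m)\<bar> \<le> (T m - T (Suc m)) + r / real m * T m" using dL m by simp
  qed (use EF in auto)
  also have "\<dots> = (\<Sum>m=1..n. (E + F) * (real m * (T m - T (Suc m)) + r * T m))"
    by (intro sum.cong refl) (simp add: field_simps)
  also have "\<dots> = (E + F) * (1 + r) * (\<Sum>m=1..n. T m)"
    by (simp only: sum_distrib_left[symmetric] sum.distrib parts) (simp add: algebra_simps)
  also have "\<dots> \<le> (E + F) * (1 + r) * (real n * C)"
    using Tsum EF r by (intro mult_left_mono) auto
  finally show ?thesis by (simp add: mult_ac)
qed

text \<open>For \<open>m \<le> n\<close> the hypothesis gives partial sums at most
  \<open>\<delta> * ln n * m + F\<close>. The constant of the majorant does not depend on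
  \<open>n\<close>, so for large \<open>n\<close> the term \<open>F\<close> is dominated by
  \<open>\<delta> * ln n\<close>.\<close>

lemma weighted_sum_small:
  fixes b :: "nat \<Rightarrow> complex"
  assumes S: "\<And>\<epsilon>. \<epsilon> > 0 \<Longrightarrow> \<exists>C. \<forall>m\<ge>1. cmod (\<Sum>k=1..m. b k * of_nat (m div k)) \<le> \<epsilon> * real m * ln (real m) + C"
    and "\<epsilon> > 0"
  shows "\<forall>\<^sub>F n in sequentially. \<forall>r. 0 \<le> r \<longrightarrow> r \<le> 16 / ln (real n) \<longrightarrow>
     cmod (\<Sum>k=1..n. b k * of_real (cut 0 (r * ln (real k))) * of_nat (n div k)) \<le> \<epsilon> * real n * ln (real n)"
proof -
  obtain C where C: "C > 0" and maj:
    "\<And>n. n \<ge> 2 \<Longrightarrow> \<exists>B. (\<forall>j. B j \<ge> 0) \<and> (\<Sum>j=1..n. B j / real j) \<le> C \<and>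
       (\<forall>r i x j. 0 \<le> r \<longrightarrow> r \<le> 16 / ln (real n) \<longrightarrow> i \<le> 1 \<longrightarrow> x \<ge> 0 \<longrightarrow> \<bar>alt_sum r i x j\<bar> \<le> B j)"
    using alt_sum_majorant by blast
  \<comment> \<open>The 4 pays for two factors 2: \<open>1 + r \<le> 2\<close> once
    \<open>ln n \<ge> 16\<close>, and \<open>F \<le> \<delta> * ln n\<close>.\<close>
  define \<delta> where "\<delta> = \<epsilon> / (4 * C)"
  have \<delta>: "\<delta> > 0" using C assms by (simp add: \<delta>_def)
  from S[OF this] obtain F0 where F0: "\<And>m. m \<ge> 1 \<Longrightarrow> cmod (\<Sum>k=1..m. b k * of_nat (m div k)) \<le> \<delta> * real m * ln (real m) + F0"
    by blast
  define F where "F = max 0 F0"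
  have lim: "filterlim (\<lambda>n. ln (real n)) at_top sequentially"
    by (rule filterlim_compose[OF ln_at_top filterlim_real_sequentially])
  have ev1: "\<forall>\<^sub>F n in sequentially. ln (real n) \<ge> 16" using lim by (auto simp: filterlim_at_top)
  have ev2: "\<forall>\<^sub>F n in sequentially. ln (real n) \<ge> F / \<delta>" using lim by (auto simp: filterlim_at_top)
  show ?thesis
    using ev1 ev2 eventually_ge_at_top[of 2]
  proof eventually_elim
    case (elim n)
    show ?case
    proof (intro allI impI)
      fix r :: real assume r: "0 \<le> r" "r \<le> 16 / ln (real n)"
      obtain B where B: "\<And>j. B j \<ge> 0" "(\<Sum>j=1..n. B j / real j) \<le> C"
         "\<And>i x j. i \<le> 1 \<Longrightarrow> x \<ge> 0 \<Longrightarrow> \<bar>alt_sum r i x j\<bar> \<le> B j"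
        using maj[OF elim(3)] r by blast
      have r1: "r \<le> 1" using r(2) elim(1) by (elim order_trans) (simp add: field_simps)
      have L0: "ln (real n) > 0" using elim by simp
      have "cmod (\<Sum>k=1..n. b k * of_real (cut 0 (r * ln (real k))) * of_nat (n div k))
         \<le> (\<delta> * ln (real n) + F) * (1 + r) * real n * C"
      proof (rule weighted_sum_bound)
        fix m assume m: "1 \<le> m" "m \<le> n"
        have "cmod (\<Sum>k=1..m. b k * of_nat (m div k)) \<le> \<delta> * real m * ln (real m) + F"
          using F0[OF m(1)] by (simp add: F_def)
        also have "\<delta> * real m * ln (real m) \<le> \<delta> * real m * ln (real n)"
          using m \<delta> by (intro mult_left_mono) auto
        finally show "cmod (\<Sum>k=1..m. b k * of_nat (m div k)) \<le> \<delta> * ln (real n) * real m + F" by (simp add: mult_ac)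
      qed (use elim r B \<delta> L0 in \<open>auto simp: F_def\<close>)
      also have "\<dots> \<le> (\<delta> * ln (real n) + \<delta> * ln (real n)) * 2 * real n * C"
        using elim(2) r1 r(1) C \<delta> L0
        by (intro mult_right_mono mult_mono add_mono) (auto simp: field_simps F_def)
      also have "\<dots> = \<epsilon> * real n * ln (real n)" using C by (simp add: \<delta>_def field_simps)
      finally show "cmod (\<Sum>k=1..n. b k * of_real (cut 0 (r * ln (real k))) * of_nat (n div k)) \<le> \<epsilon> * real n * ln (real n)" .
    qed
  qed
qed

text \<open>All weights are 1 at \<open>r = 0\<close>, so the error is the change of the weighted
  sum between 0 and \<open>r\<close>. The interval length \<open>16 / ln n\<close> cancels the
  factor \<open>ln n\<close> in the bound for the derivative.\<close>

lemma truncation_error: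
  fixes a :: "nat \<Rightarrow> complex"
  assumes S: "\<And>\<epsilon>. \<epsilon> > 0 \<Longrightarrow> \<exists>C. \<forall>m\<ge>1. cmod (\<Sum>k=1..m. a k * of_real (ln (real k)) * of_nat (m div k)) \<le> \<epsilon> * real m * ln (real m) + C"
    and "\<epsilon> > 0"
  shows "\<forall>\<^sub>F n in sequentially. \<forall>r. 0 \<le> r \<longrightarrow> r \<le> 16 / ln (real n) \<longrightarrow>
     cmod ((\<Sum>k=1..n. a k * of_nat (n div k))
       - (\<Sum>k=1..n. a k * of_real (max 0 (1 - r * ln (real k)) ^ 8) * of_nat (n div k))) \<le> \<epsilon> * real n"
proof -
  \<comment> \<open>128 = 8 * 16: the exponent 8 comes down on differentiation, and 16 is the
    numerator of the interval length.\<close>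
  have "\<forall>\<^sub>F n in sequentially. \<forall>r. 0 \<le> r \<longrightarrow> r \<le> 16 / ln (real n) \<longrightarrow>
     cmod (\<Sum>k=1..n. a k * of_real (ln (real k)) * of_real (cut 0 (r * ln (real k))) * of_nat (n div k))
       \<le> \<epsilon> / 128 * real n * ln (real n)"
    by (rule weighted_sum_small) (use assms in simp_all)
  then show ?thesis using eventually_ge_at_top[of 2]
  proof eventually_elim
    case (elim n)
    show ?case
    proof (intro allI impI)
      fix r :: real assume r: "0 \<le> r" "r \<le> 16 / ln (real n)"
      define G where "G r = (\<Sum>k=1..n. a k * of_real (max 0 (1 - r * ln (real k)) ^ 8) * of_nat (n div k))" for r
      define H where "H r = (\<Sum>k=1..n. a k * of_real (ln (real k)) * of_real (cut 0 (r * ln (real k))) * of_nat (n div k))" for r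
      have L0: "ln (real n) > 0" using elim by simp
      have der: "(G has_vector_derivative - 8 * H r) (at r)" for r
      proof -
        have d: "((\<lambda>r. max 0 (1 - r * ln (real k)) ^ 8) has_real_derivative - 8 * ln (real k) * cut 0 (r * ln (real k))) (at r)" for k :: nat
        proof -
          have "((\<lambda>r. r * ln (real k)) has_real_derivative ln (real k)) (at r)" 
            by (auto intro!: derivative_eq_intros)
          from DERIV_chain2[OF has_real_derivative_pos_part_power[of 6] this] show ?thesis
            by (simp add: cut_0 mult_ac)
        qed
        have "((\<lambda>r. a k * of_real (max 0 (1 - r * ln (real k)) ^ 8) * of_nat (n div k)) has_vector_derivative
           a k * of_real (- 8 * ln (real k) * cut 0 (r * ln (real k))) * of_nat (n div k)) (at r)" for k
          by (intro has_vector_derivative_mult_left has_vector_derivative_mult_right has_vector_derivative_of_real)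
             (use d in \<open>simp add: has_real_derivative_iff_has_vector_derivative\<close>)
        then have "(G has_vector_derivative (\<Sum>k=1..n. a k * of_real (- 8 * ln (real k) * cut 0 (r * ln (real k))) * of_nat (n div k))) (at r)"
          unfolding G_def by (intro has_vector_derivative_sum)
        also have "(\<Sum>k=1..n. a k * of_real (- 8 * ln (real k) * cut 0 (r * ln (real k))) * of_nat (n div k)) = - 8 * H r"
          unfolding H_def sum_distrib_left by (intro sum.cong refl) simp
        finally show ?thesis .
      qed
      have "cmod (G r - G 0) \<le> \<epsilon> * real n"
      proof (cases "r = 0")
        case False
        have "continuous_on {0..r} G"
          by (intro continuous_at_imp_continuous_on ballI has_vector_derivative_continuous[OF der])
        \<comment> \<open>For complex values the mean value theorem is available as an inequality of
          norms.\<close>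
        then obtain x where x: "0 < x" "x < r" "cmod (G r - G 0) \<le> cmod ((r - 0) *\<^sub>R (- 8 * H x))"
          using mvt_general[of 0 r G "\<lambda>x h. h *\<^sub>R (- 8 * H x)"] False r der
          by (force simp: has_vector_derivative_def)
        have "cmod (H x) \<le> \<epsilon> / 128 * real n * ln (real n)"
          unfolding H_def using elim x r by auto
        then have "r * (8 * cmod (H x)) \<le> 16 / ln (real n) * (8 * (\<epsilon> / 128 * real n * ln (real n)))"
          using r L0 by (intro mult_mono) auto
        also have "\<dots> = \<epsilon> * real n" using L0 by (simp add: field_simps)
        finally show ?thesis using x r by (simp add: norm_mult)
      qed (use assms in simp)
      moreover have "G 0 = (\<Sum>k=1..n. a k * of_nat (n div k))" by (simp add: G_def)
      ultimately show "cmod ((\<Sum>k=1..n. a k * of_nat (n div k))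
       - (\<Sum>k=1..n. a k * of_real (max 0 (1 - r * ln (real k)) ^ 8) * of_nat (n div k))) \<le> \<epsilon> * real n"
        by (simp add: G_def norm_minus_commute)
    qed
  qed
qed

section \<open>Slow oscillation of the means\<close>

abbreviation floor_sum :: "(nat \<Rightarrow> complex) \<Rightarrow> nat \<Rightarrow> complex" where
  "floor_sum u n \<equiv> (\<Sum>k=1..n. u k * of_nat (n div k))"

text \<open>Differences of consecutive floor sums bound the divisor sums of \<open>b\<close>,
  Moebius inversion bounds \<open>b\<close>, and dividing by the logarithm bounds \<open>a\<close>.
  The crude cubic growth is enough because only \<open>k \<le> n powr (1 / 8)\<close> will
  matter.\<close>

lemma coeff_polynomial_bound:
  fixes a :: "nat \<Rightarrow> complex"
  assumes S: "\<And>m. m \<ge> 1 \<Longrightarrow> cmod (floor_sum (\<lambda>k. a k * of_real (ln (real k))) m) \<le> real m * ln (real m) + C"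
  obtains M where "M \<ge> 0" "\<And>k. k \<ge> 1 \<Longrightarrow> cmod (a k) \<le> M * real k ^ 3"
proof -
  define b where "b k = a k * of_real (ln (real k))" for k
  define s where "s m = (\<Sum>k | k dvd m. b k)" for m
  define D where "D = 1 + max 0 C"
  have D: "D \<ge> 1" by (simp add: D_def)
  have Sn: "(\<Sum>i=1..m. s i) = floor_sum b m" for m
    unfolding s_def by (rule sum_sum_divisors)
  have S': "cmod (\<Sum>i=1..m. s i) \<le> D * real m ^ 2" for m
  proof (cases "m = 0")
    case False
    then have m: "m \<ge> 1" by simp
    have "cmod (\<Sum>i=1..m. s i) \<le> real m * ln (real m) + C" unfolding Sn using S[OF m] by (simp add: b_def)
    also have "real m * ln (real m) \<le> real m * real m"
      using m ln_le_minus_one[of "real m"] by (intro mult_left_mono) auto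
    also have "C \<le> max 0 C * real m ^ 2" 
    proof -
      have "max 0 C * 1 \<le> max 0 C * real m ^ 2" using m by (intro mult_left_mono) auto
      then show ?thesis by simp
    qed
    finally show ?thesis by (simp add: D_def power2_eq_square algebra_simps)
  qed simp
  have s: "cmod (s m) \<le> 2 * D * real m ^ 2" if m1: "m \<ge> 1" for m
  proof -
    obtain m' where m': "m = Suc m'" using m1 by (metis Suc_le_D One_nat_def)
    have "s m = (\<Sum>i=1..m. s i) - (\<Sum>i=1..m'. s i)" by (simp add: m')
    then have "cmod (s m) \<le> D * real m ^ 2 + D * real m' ^ 2"
      using S'[of m] S'[of m'] norm_triangle_ineq4[of "\<Sum>i=1..m. s i" "\<Sum>i=1..m'. s i"] by simp
    also have "\<dots> \<le> D * real m ^ 2 + D * real m ^ 2"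
      using D m' by (intro add_left_mono mult_left_mono power_mono) auto
    finally show ?thesis by simp
  qed
  have b: "cmod (b k) \<le> 2 * D * real k ^ 3" if k: "k \<ge> 1" for k
  proof -
    have "b k = (\<Sum>d | d dvd k. of_real (mob d) * s (k div d))"
      unfolding s_def by (rule mob_inversion[OF k, symmetric])
    then have "cmod (b k) \<le> (\<Sum>d | d dvd k. cmod (of_real (mob d) * s (k div d)))"
      by (simp add: norm_sum)
    also have "\<dots> \<le> (\<Sum>d | d dvd k. 1 * (2 * D * real k ^ 2))"
      unfolding norm_mult
    proof (intro sum_mono mult_mono)
      fix d assume d: "d \<in> {d. d dvd k}"
      then have "k div d \<ge> 1" using k by (auto elim!: dvdE)
      then have "cmod (s (k div d)) \<le> 2 * D * real (k div d) ^ 2" by (rule s)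
      also have "\<dots> \<le> 2 * D * real k ^ 2" using D by (intro mult_left_mono power_mono) auto
      finally show "cmod (s (k div d)) \<le> 2 * D * real k ^ 2" .
    qed (auto simp: abs_mob_le)
    also have "\<dots> = real (card {d. d dvd k}) * (2 * D * real k ^ 2)" by simp
    also have "\<dots> \<le> real k * (2 * D * real k ^ 2)"
    proof (intro mult_right_mono of_nat_mono)
      have "{d. d dvd k} \<subseteq> {1..k}" using k by (auto simp: Suc_le_eq intro: dvd_imp_le dvd_pos_nat)
      then show "card {d. d dvd k} \<le> k" using card_mono[of "{1..k}"] by fastforce
    qed (use D in auto)
    finally show ?thesis by (simp add: power2_eq_square power3_eq_cube mult_ac)
  qed
  show thesis
  \<comment> \<open>\<open>a 1\<close> enters separately because \<open>ln 1 = 0\<close> hides it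
    from \<open>b\<close>. For \<open>k \<ge> 2\<close> the bound \<open>ln k \<ge> 2 / 3\<close>
    turns \<open>2 * D\<close> into \<open>3 * D\<close>.\<close>
  proof (rule that[of "cmod (a 1) + 3 * D"])
    fix k :: nat assume k: "k \<ge> 1"
    show "cmod (a k) \<le> (cmod (a 1) + 3 * D) * real k ^ 3"
    proof (cases "k = 1")
      case False
      then have "ln 2 \<le> ln (real k)" using k by simp
      then have l: "2 / 3 \<le> ln (real k)" using ln2_ge_two_thirds by linarith
      have "2 / 3 * cmod (a k) \<le> cmod (b k)"
        using l mult_right_mono[OF l, of "cmod (a k)"] by (simp add: b_def norm_mult mult.commute)
      also note b[OF k]
      finally have "cmod (a k) \<le> 3 * D * real k ^ 3" by (simp add: field_simps)
      also have "\<dots> \<le> (cmod (a 1) + 3 * D) * real k ^ 3" by (intro mult_right_mono) auto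
      finally show ?thesis .
    qed (use D in simp)
  qed (use D in simp)
qed

text \<open>Both quotients fall short of \<open>1 / k\<close> by an amount between 0 and
  \<open>1 / n\<close>.\<close>

lemma floor_quotient_diff:
  assumes "1 \<le> n" "n \<le> N"
  shows "\<bar>real (N div k) / real N - real (n div k) / real n\<bar> \<le> 1 / real n"
proof (cases "k = 0")
  case False
  have *: "\<exists>\<theta>. 0 \<le> \<theta> \<and> \<theta> \<le> 1 / real n \<and> real (m div k) / real m = 1 / real k - \<theta>" if m: "n \<le> m" for m
  proof (intro exI[of _ "real (m mod k) / (real k * real m)"] conjI)
    have m0: "m > 0" using m assms by simp
    have "real (m mod k) / (real k * real m) \<le> real k / (real k * real m)"
      using False by (intro divide_right_mono) (auto intro: less_imp_le)
    also have "\<dots> \<le> 1 / real n" using False m m0 assms by (simp add: field_simps)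
    finally show "real (m mod k) / (real k * real m) \<le> 1 / real n" .
    have "real m = real k * real (m div k) + real (m mod k)"
      by (metis mult_div_mod_eq of_nat_add of_nat_mult)
    then have "real (m mod k) = real m - real k * real (m div k)" by simp
    then show "real (m div k) / real m = 1 / real k - real (m mod k) / (real k * real m)"
      using False m0 by (simp add: field_simps)
  qed simp
  from *[of n] *[of N] assms show ?thesis by fastforce
qed (use assms in simp)

text \<open>With \<open>r = 8 / ln n\<close> the same weights truncate both sums at \<open>k \<le> n powr (1 / 8)\<close>, where
  \<open>N div k / N\<close> and \<open>n div k / n\<close> agree up to \<open>1 / n\<close>.\<close>

lemma slow_oscillation:
  fixes a :: "nat \<Rightarrow> complex"
  assumes S: "\<And>\<epsilon>. \<epsilon> > 0 \<Longrightarrow> \<exists>C. \<forall>m\<ge>1. cmod (floor_sum (\<lambda>k. a k * of_real (ln (real k))) m) \<le> \<epsilon> * real m * ln (real m) + C"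
    and \<epsilon>: "\<epsilon> > 0"
  shows "\<forall>\<^sub>F n in sequentially. \<forall>N. n \<le> N \<longrightarrow> N \<le> n ^ 2 \<longrightarrow>
     cmod (floor_sum a N / of_nat N - floor_sum a n / of_nat n) \<le> \<epsilon>"
proof -
  from S[of 1] obtain C where C: "\<And>m. m \<ge> 1 \<Longrightarrow> cmod (floor_sum (\<lambda>k. a k * of_real (ln (real k))) m) \<le> real m * ln (real m) + C"
    by auto
  obtain M where M: "M \<ge> 0" "\<And>k. k \<ge> 1 \<Longrightarrow> cmod (a k) \<le> M * real k ^ 3"
    using coeff_polynomial_bound[of a C] C by blast
  define W where "W r n = (\<Sum>k=1..n. a k * of_real (max 0 (1 - r * ln (real k)) ^ 8) * of_nat (n div k))" for r n
  have "\<forall>\<^sub>F n in sequentially. \<forall>r. 0 \<le> r \<longrightarrow> r \<le> 16 / ln (real n) \<longrightarrow>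
     cmod (floor_sum a n - W r n) \<le> \<epsilon> / 3 * real n"
    unfolding W_def by (rule truncation_error[OF S]) (use \<epsilon> in simp_all)
  then obtain n0 where n0: "\<And>n r. n \<ge> n0 \<Longrightarrow> 0 \<le> r \<Longrightarrow> r \<le> 16 / ln (real n) \<Longrightarrow>
     cmod (floor_sum a n - W r n) \<le> \<epsilon> / 3 * real n"
    unfolding eventually_sequentially by blast
  have tr: "cmod (floor_sum a n / of_nat n - W r n / of_nat n) \<le> \<epsilon> / 3"
    if "n \<ge> n0" "0 \<le> r" "r \<le> 16 / ln (real n)" "n \<ge> 1" for n r
  proof -
    have "cmod (floor_sum a n / of_nat n - W r n / of_nat n) = cmod (floor_sum a n - W r n) / real n"
      by (simp add: diff_divide_distrib[symmetric] norm_divide)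
    also have "\<dots> \<le> \<epsilon> / 3" using n0[OF that(1-3)] that(4) by (simp add: field_simps)
    finally show ?thesis .
  qed
  have lim: "((\<lambda>n. M * real n powr (- 1 / 2)) \<longlongrightarrow> 0) sequentially"
    by (intro tendsto_mult_right_zero tendsto_neg_powr filterlim_real_sequentially) auto
  have ev: "\<forall>\<^sub>F n in sequentially. M * real n powr (- 1 / 2) < \<epsilon> / 3"
    using order_tendstoD(2)[OF lim, of "\<epsilon> / 3"] \<epsilon> by simp
  show ?thesis
    using ev eventually_ge_at_top[of n0] eventually_ge_at_top[of 2]
  proof eventually_elim
    case (elim n)
    show ?case
    proof (intro allI impI)
      fix N assume N: "n \<le> N" "N \<le> n ^ 2"
      \<comment> \<open>\<open>N \<le> n ^ 2\<close> gives \<open>8 / ln n \<le> 16 / ln N\<close>,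
        so \<open>truncation_error\<close> covers this \<open>r\<close> at \<open>N\<close> as well
        as at \<open>n\<close>.\<close>
      define r where "r = 8 / ln (real n)"
      have Ln: "ln (real n) > 0" using elim by simp
      have r0: "r \<ge> 0" using Ln by (simp add: r_def)
      have LN: "ln (real N) \<le> 2 * ln (real n)"
      proof -
        have "real N \<le> real n ^ 2" using N(2) by (metis of_nat_le_iff of_nat_power)
        then have "ln (real N) \<le> ln (real n ^ 2)" using elim N by (subst ln_le_cancel_iff) auto
        then show ?thesis using elim by (simp add: ln_realpow)
      qed
      have LN0: "ln (real N) > 0" using elim N by simp
      have 1: "cmod (floor_sum a n / of_nat n - W r n / of_nat n) \<le> \<epsilon> / 3"
        using elim r0 Ln by (intro tr) (auto simp: r_def field_simps)
      have 2: "cmod (floor_sum a N / of_nat N - W r N / of_nat N) \<le> \<epsilon> / 3"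
        using elim r0 Ln LN LN0 N by (intro tr) (auto simp: r_def field_simps)
      define w where "w k = max 0 (1 - r * ln (real k)) ^ 8" for k :: nat
      define q where "q = real n powr (1 / 8)"
      have q1: "q \<ge> 1" unfolding q_def using elim by (intro ge_one_powr_ge_zero) auto
      have wz: "w k = 0" if "k \<ge> 1" "real k > q" for k
      proof -
        have "ln q < ln (real k)" using that q1 by simp
        then have "ln (real n) / 8 < ln (real k)" using elim by (simp add: q_def ln_powr)
        then have "r * (ln (real n) / 8) \<le> r * ln (real k)" using r0 by (intro mult_left_mono) auto
        then have "1 - r * ln (real k) \<le> 0" using Ln by (simp add: r_def)
        then show ?thesis by (simp add: w_def max_def)
      qed
      have w1: "\<bar>w k\<bar> \<le> 1" if "k \<ge> 1" for k
        unfolding w_def using that r0 by (auto simp: power_abs max_def intro!: power_le_one)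
      have eN: "W r N / of_nat N = (\<Sum>k=1..N. a k * of_real (w k) * of_real (real (N div k) / real N))"
        unfolding W_def w_def by (simp add: sum_divide_distrib)
      have "W r n / of_nat n = (\<Sum>k=1..n. a k * of_real (w k) * of_real (real (n div k) / real n))"
        unfolding W_def w_def by (simp add: sum_divide_distrib)
      also have "\<dots> = (\<Sum>k=1..N. a k * of_real (w k) * of_real (real (n div k) / real n))"
        using N by (intro sum.mono_neutral_left) auto
      finally have en: "W r n / of_nat n = (\<Sum>k=1..N. a k * of_real (w k) * of_real (real (n div k) / real n))" .
      have "W r N / of_nat N - W r n / of_nat n
          = (\<Sum>k=1..N. a k * of_real (w k) * of_real (real (N div k) / real N - real (n div k) / real n))"
        unfolding eN en sum_subtractf[symmetric] by (intro sum.cong refl) (simp add: algebra_simps)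
      then have "cmod (W r N / of_nat N - W r n / of_nat n)
          \<le> (\<Sum>k=1..N. cmod (a k * of_real (w k) * of_real (real (N div k) / real N - real (n div k) / real n)))"
        by (simp only: norm_sum)
      also have "\<dots> = (\<Sum>k\<in>{1..N} \<inter> {..nat \<lfloor>q\<rfloor>}. cmod (a k * of_real (w k) * of_real (real (N div k) / real N - real (n div k) / real n)))"
      proof (intro sum.mono_neutral_right ballI)
        fix k assume k: "k \<in> {1..N} - {1..N} \<inter> {..nat \<lfloor>q\<rfloor>}"
        then have "k > nat \<lfloor>q\<rfloor>" by auto
        then have "real k > q" using q1 by linarith
        then have "w k = 0" using wz k by simp
        then show "cmod (a k * of_real (w k) * of_real (real (N div k) / real N - real (n div k) / real n)) = 0" by simp
      qed auto
      also have "\<dots> \<le> (\<Sum>k\<in>{1..N} \<inter> {..nat \<lfloor>q\<rfloor>}. M * q ^ 3 * 1 * (1 / real n))"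
        unfolding norm_mult
      proof (intro sum_mono mult_mono)
        fix k assume "k \<in> {1..N} \<inter> {..nat \<lfloor>q\<rfloor>}"
        then have k: "k \<ge> 1" "real k \<le> q" using q1 by (auto simp: le_nat_iff le_floor_iff)
        have "cmod (a k) \<le> M * real k ^ 3" using M k by simp
        also have "\<dots> \<le> M * q ^ 3" using M k by (intro mult_left_mono power_mono) auto
        finally show "cmod (a k) \<le> M * q ^ 3" .
        show "cmod (of_real (w k)) \<le> 1" using w1[OF k(1)] by simp
        show "cmod (of_real (real (N div k) / real N - real (n div k) / real n)) \<le> 1 / real n"
          using floor_quotient_diff[of n N k] elim N by (simp only: norm_of_real)
      qed (use M q1 in auto)
      also have "\<dots> = real (card ({1..N} \<inter> {..nat \<lfloor>q\<rfloor>})) * (M * q ^ 3 / real n)" by simp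
      also have "\<dots> \<le> q * (M * q ^ 3 / real n)"
      proof (intro mult_right_mono)
        have "card ({1..N} \<inter> {..nat \<lfloor>q\<rfloor>}) \<le> card {1..nat \<lfloor>q\<rfloor>}" by (intro card_mono) auto
        then have "card ({1..N} \<inter> {..nat \<lfloor>q\<rfloor>}) \<le> nat \<lfloor>q\<rfloor>" by simp
        then show "real (card ({1..N} \<inter> {..nat \<lfloor>q\<rfloor>})) \<le> q" using q1 by linarith
      qed (use M q1 in auto)
      \<comment> \<open>At most \<open>q\<close> terms of size \<open>M * q ^ 3 / n\<close> with
        \<open>q = n powr (1 / 8)\<close> give a total of order
        \<open>n powr (- 1 / 2)\<close>.\<close>
      also have "\<dots> = M * (q ^ 4 / real n)" by (simp add: eval_nat_numeral)
      also have "q ^ 4 / real n = real n powr (- 1 / 2)"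
      proof -
        have "q ^ 4 = real n powr (1 / 2)" using elim unfolding q_def
          by (subst powr_realpow[symmetric]) (auto simp: powr_powr)
        also have "\<dots> / real n = real n powr (1 / 2 - 1)" using elim by (subst powr_diff) auto
        finally show ?thesis by simp
      qed
      finally have 3: "cmod (W r N / of_nat N - W r n / of_nat n) \<le> \<epsilon> / 3" using elim by linarith
      have "floor_sum a N / of_nat N - floor_sum a n / of_nat n
        = (floor_sum a N / of_nat N - W r N / of_nat N) + (W r N / of_nat N - W r n / of_nat n)
          - (floor_sum a n / of_nat n - W r n / of_nat n)" by simp
      also have "cmod \<dots> \<le> cmod (floor_sum a N / of_nat N - W r N / of_nat N) + cmod (W r N / of_nat N - W r n / of_nat n)
          + cmod (floor_sum a n / of_nat n - W r n / of_nat n)"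
        by (rule order_trans[OF norm_triangle_ineq4 add_right_mono[OF norm_triangle_ineq]])
      also have "\<dots> \<le> \<epsilon>" using 1 2 3 by linarith
      finally show "cmod (floor_sum a N / of_nat N - floor_sum a n / of_nat n) \<le> \<epsilon>" .
    qed
  qed
qed

text \<open>Walk from \<open>n\<close> to \<open>N\<close> by repeated squaring. Each squaring
  halves \<open>ln N / ln n\<close> and costs at most \<epsilon>, so the number of steps is governed
  by the binary logarithm of this ratio.\<close>

lemma oscillation_chain:
  fixes \<alpha> :: "nat \<Rightarrow> complex"
  assumes osc: "\<And>n N. n \<ge> n0 \<Longrightarrow> n \<le> N \<Longrightarrow> N \<le> n ^ 2 \<Longrightarrow> cmod (\<alpha> N - \<alpha> n) \<le> \<epsilon>"
    and n0: "n0 \<ge> 2" and n: "n0 \<le> n" "n \<le> N" and \<epsilon>: "\<epsilon> \<ge> 0"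
  shows "cmod (\<alpha> N - \<alpha> n) \<le> \<epsilon> * (1 + log 2 (ln (real N) / ln (real n)))"
  using n
proof (induction "N - n" arbitrary: n rule: less_induct)
  case less
  have Ln: "ln (real n) > 0" "ln (real N) \<ge> ln (real n)" using less.prems n0 by auto
  show ?case
  proof (cases "N \<le> n ^ 2")
    case True
    have "0 \<le> log 2 (ln (real N) / ln (real n))" using Ln by (subst zero_le_log_cancel_iff) auto
    then have "\<epsilon> * 1 \<le> \<epsilon> * (1 + log 2 (ln (real N) / ln (real n)))" using \<epsilon> by (intro mult_left_mono) auto
    then show ?thesis using osc[of n N] True less.prems by simp
  next
    case False
    have nn: "n < n ^ 2" using less.prems n0 by (simp add: power2_eq_square)
    have IH: "cmod (\<alpha> N - \<alpha> (n ^ 2)) \<le> \<epsilon> * (1 + log 2 (ln (real N) / ln (real (n ^ 2))))"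
      using False nn less.prems by (intro less.hyps) auto
    have "log 2 (ln (real N) / ln (real (n ^ 2))) = log 2 (ln (real N) / ln (real n) / 2)"
      using less.prems n0 by (simp add: ln_realpow mult.commute)
    also have "\<dots> = log 2 (ln (real N) / ln (real n)) - 1"
      using Ln by (subst log_divide) auto
    finally have "cmod (\<alpha> N - \<alpha> (n ^ 2)) \<le> \<epsilon> * log 2 (ln (real N) / ln (real n))" using IH by simp
    moreover have "cmod (\<alpha> (n ^ 2) - \<alpha> n) \<le> \<epsilon>" using less.prems nn by (intro osc) auto
    moreover have "cmod (\<alpha> N - \<alpha> n) \<le> cmod (\<alpha> N - \<alpha> (n ^ 2)) + cmod (\<alpha> (n ^ 2) - \<alpha> n)"
      using norm_triangle_ineq[of "\<alpha> N - \<alpha> (n ^ 2)" "\<alpha> (n ^ 2) - \<alpha> n"] by simp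
    ultimately show ?thesis by (simp add: algebra_simps)
  qed
qed

section \<open>Dirichlet series\<close>

lemma powr_minus_antimono: "t \<ge> 0 \<Longrightarrow> n \<ge> 1 \<Longrightarrow> real (Suc n) powr (- t) \<le> real n powr (- t)"
  by (intro powr_mono2') auto

lemma sum_powr_le:
  assumes s: "s > 0"
  shows "(\<Sum>k=1..n. real k powr (- 1 - s)) \<le> 1 + 1 / s"
proof -
  have "(\<Sum>k=1..n. real k powr (- 1 - s)) \<le> 1 + (1 - real n powr (- s)) / s" if "n \<ge> 1"
    using that
  proof (induction n rule: nat_induct_at_least)
    case (Suc n)
    have "\<exists>z. real n < z \<and> z < real (Suc n) \<and>
        real (Suc n) powr (- s) - real n powr (- s) = (real (Suc n) - real n) * (- s * z powr (- s - 1))"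
      using Suc by (intro MVT2) (auto intro!: derivative_eq_intros)
    then obtain z where z: "real n < z" "z < real (Suc n)" "real (Suc n) powr (- s) - real n powr (- s) = - s * z powr (- s - 1)"
      by auto
    have "real (Suc n) powr (- s - 1) \<le> z powr (- s - 1)"
      using z Suc s by (intro powr_mono2') auto
    then have "s * real (Suc n) powr (- s - 1) \<le> s * z powr (- s - 1)" using s by simp
    also have "\<dots> = real n powr (- s) - real (Suc n) powr (- s)" using z(3) by linarith
    finally have "real (Suc n) powr (- s - 1) \<le> (real n powr (- s) - real (Suc n) powr (- s)) / s"
      using s by (simp add: pos_le_divide_eq mult.commute)
    moreover have "- s - 1 = - 1 - s" by simp
    ultimately have "real (Suc n) powr (- 1 - s) \<le> (real n powr (- s) - real (Suc n) powr (- s)) / s" by metis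
    then have "(\<Sum>k=1..Suc n. real k powr (- 1 - s)) \<le> 1 + (1 - real n powr (- s)) / s + (real n powr (- s) - real (Suc n) powr (- s)) / s"
      using Suc.IH by simp
    then show ?case by (simp add: diff_divide_distrib)
  qed simp
  moreover have "(1 - real n powr (- s)) / s \<le> 1 / s" using s by (intro divide_right_mono) auto
  ultimately show ?thesis using s by (cases "n \<ge> 1") (auto simp: not_le)
qed

lemma sums_iff_tendsto_from_1: "(\<lambda>m. f (Suc m)) sums l \<longleftrightarrow> (\<lambda>n. \<Sum>k=1..n. f k) \<longlonglongrightarrow> l"
  by (simp add: sums_def sum.atLeast1_atMost_eq)

text \<open>Abel summation: partial sums of order \<open>m powr \<tau>\<close> meet differences of
  order \<open>m powr (- 1 - \<sigma>)\<close>, and the boundary term decays like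
  \<open>n powr (\<tau> - \<sigma>)\<close>.\<close>

lemma dirichlet_convergent:
  fixes u :: "nat \<Rightarrow> complex"
  assumes A: "\<And>m. m \<ge> 1 \<Longrightarrow> cmod (\<Sum>k=1..m. u k) \<le> C * real m powr \<tau>" and \<tau>: "\<tau> < \<sigma>" and \<sigma>: "\<sigma> > 0"
  shows "summable (\<lambda>m. u (Suc m) * of_real (real (Suc m) powr (- \<sigma>)))"
proof -
  define L where "L m = complex_of_real (real m powr (- \<sigma>))" for m :: nat
  define A where "A m = (\<Sum>k=1..m. u k)" for m
  have C: "C \<ge> 0" using order_trans[OF norm_ge_zero A[of 1]] by simp
  have dL: "cmod (L m - L (Suc m)) \<le> \<sigma> * real m powr (- 1 - \<sigma>)" if "m \<ge> 1" for m
    using powr_minus_diff_le[OF \<sigma> that] powr_minus_antimono[of \<sigma> m] that \<sigma>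
    unfolding L_def of_real_diff[symmetric] norm_of_real by simp
  have "summable (\<lambda>m. A (Suc m) * (L (Suc m) - L (Suc (Suc m))))"
  proof (rule summable_comparison_test')
    have "summable (\<lambda>m. real m powr (\<tau> - \<sigma> - 1))" using \<tau> by (simp add: summable_real_powr_iff)
    then show "summable (\<lambda>m. C * \<sigma> * real (Suc m) powr (\<tau> - \<sigma> - 1))"
      by (intro summable_mult) (subst summable_Suc_iff[of "\<lambda>m. real m powr (\<tau> - \<sigma> - 1)"])
    show "norm (A (Suc m) * (L (Suc m) - L (Suc (Suc m)))) \<le> C * \<sigma> * real (Suc m) powr (\<tau> - \<sigma> - 1)" if "m \<ge> 0" for m
    proof -
      have "norm (A (Suc m) * (L (Suc m) - L (Suc (Suc m)))) \<le> (C * real (Suc m) powr \<tau>) * (\<sigma> * real (Suc m) powr (- 1 - \<sigma>))"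
        unfolding norm_mult A_def using C \<sigma> by (intro mult_mono A dL) auto
      also have "\<dots> = C * \<sigma> * real (Suc m) powr (\<tau> + (- 1 - \<sigma>))"
        unfolding powr_add by (simp add: mult_ac)
      finally show ?thesis by (simp add: algebra_simps)
    qed
  qed
  then obtain l where "(\<lambda>m. A (Suc m) * (L (Suc m) - L (Suc (Suc m)))) sums l" by (auto simp: summable_def)
  then have 1: "(\<lambda>n. \<Sum>m=1..n. A m * (L m - L (Suc m))) \<longlonglongrightarrow> l"
    using sums_iff_tendsto_from_1[of "\<lambda>m. A m * (L m - L (Suc m))"] by simp
  have 2: "(\<lambda>n. A n * L (Suc n)) \<longlonglongrightarrow> 0"
  proof (rule Lim_null_comparison)
    have "((\<lambda>n. C * real n powr (\<tau> - \<sigma>)) \<longlongrightarrow> 0) sequentially"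
      using \<tau> by (intro tendsto_mult_right_zero tendsto_neg_powr filterlim_real_sequentially) auto
    then show "(\<lambda>n. C * real n powr (\<tau> - \<sigma>)) \<longlonglongrightarrow> 0" .
    show "\<forall>\<^sub>F n in sequentially. norm (A n * L (Suc n)) \<le> C * real n powr (\<tau> - \<sigma>)"
      using eventually_ge_at_top[of 1]
    proof eventually_elim
      case (elim n)
      have "norm (A n * L (Suc n)) \<le> (C * real n powr \<tau>) * real n powr (- \<sigma>)"
        unfolding norm_mult A_def L_def norm_of_real using elim C \<sigma> powr_minus_antimono[of \<sigma> n]
        by (intro mult_mono A) auto
      also have "\<dots> = C * real n powr (\<tau> - \<sigma>)" using powr_add[of "real n" \<tau> "- \<sigma>"] by simp
      finally show ?case .
    qed
  qed
  have "(\<lambda>n. \<Sum>k=1..n. u k * L k) \<longlonglongrightarrow> l + 0"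
    unfolding sum_by_parts[of u L] A_def[symmetric] by (intro tendsto_add 1 2)
  then have "(\<lambda>m. u (Suc m) * L (Suc m)) sums (l + 0)" unfolding sums_iff_tendsto_from_1[of "\<lambda>m. u m * L m"] .
  then show ?thesis by (auto simp: L_def summable_def)
qed

text \<open>Dominated convergence for sums of growing length: summability of \<open>v\<close>
  controls the tail uniformly, and the head is a finite sum of null sequences. Limits are asked only
  for \<open>j \<ge> 1\<close> because the application has \<open>h n j\<close> depending on
  \<open>n div j\<close>, and \<open>n div 0 = 0\<close>.\<close>

lemma tannery_null:
  fixes h :: "nat \<Rightarrow> nat \<Rightarrow> complex"
  assumes v: "\<And>j. v j \<ge> 0" "summable v"
    and M: "\<And>n j. cmod (h n j) \<le> M" and lim: "\<And>j. j \<ge> 1 \<Longrightarrow> (\<lambda>n. h n j) \<longlonglongrightarrow> 0"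
  shows "(\<lambda>n. \<Sum>j=1..n. of_real (v j) * h n j) \<longlonglongrightarrow> 0"
proof (rule LIMSEQ_I)
  fix e :: real assume e: "e > 0"
  have M0: "M \<ge> 0" using M[of 0 0] norm_ge_zero order_trans by blast
  have "e / (2 * (M + 1)) > 0" using e M0 by simp
  from summable_partial_sum_bound[OF v(2) this]
  obtain J where J: "\<And>m n. m \<ge> J \<Longrightarrow> norm (\<Sum>k=m..n. v k) < e / (2 * (M + 1))" by blast
  have "(\<lambda>n. \<Sum>j=1..J. of_real (v j) * h n j) \<longlonglongrightarrow> (\<Sum>j=1..J. of_real (v j) * 0)"
    by (intro tendsto_sum tendsto_mult tendsto_const lim) auto
  then have "(\<lambda>n. \<Sum>j=1..J. of_real (v j) * h n j) \<longlonglongrightarrow> 0" by simp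
  then obtain n0 where n0: "\<And>n. n \<ge> n0 \<Longrightarrow> cmod (\<Sum>j=1..J. of_real (v j) * h n j) < e / 2"
    using LIMSEQ_D[of _ 0 "e / 2"] e by force
  show "\<exists>no. \<forall>n\<ge>no. norm ((\<Sum>j=1..n. of_real (v j) * h n j) - 0) < e"
  proof (intro exI[of _ "max n0 J"] allI impI)
    fix n assume n: "n \<ge> max n0 J"
    have spl: "(\<Sum>j=1..n. of_real (v j) * h n j) = (\<Sum>j=1..J. of_real (v j) * h n j) + (\<Sum>j=Suc J..n. of_real (v j) * h n j)"
      using sum.ub_add_nat[of 1 J "\<lambda>j. of_real (v j) * h n j" "n - J"] n by simp
    have "cmod (\<Sum>j=Suc J..n. of_real (v j) * h n j) \<le> (\<Sum>j=Suc J..n. v j * M)"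
      by (rule order_trans[OF norm_sum], intro sum_mono) (auto simp: norm_mult v intro!: mult_left_mono M)
    also have "\<dots> = (\<Sum>j=Suc J..n. v j) * M" by (simp add: sum_distrib_right)
    also have "\<dots> \<le> e / (2 * (M + 1)) * M"
      using J[of "Suc J" n] M0 by (intro mult_right_mono) auto
    also have "\<dots> \<le> e / 2" using M0 e by (simp add: field_simps)
    finally show "norm ((\<Sum>j=1..n. of_real (v j) * h n j) - 0) < e"
      using n0[of n] n norm_triangle_ineq[of "\<Sum>j=1..J. of_real (v j) * h n j" "\<Sum>j=Suc J..n. of_real (v j) * h n j"]
      unfolding spl by simp
  qed
qed

text \<open>Only the factor with coefficients 1 is required to converge absolutely. Grouping by its
  variable \<open>j\<close> leaves the partial sum \<open>G (n div j)\<close> of the other factor,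
  which tends to \<open>g\<close> for each fixed \<open>j\<close>.\<close>

lemma dirichlet_product_one:
  fixes u :: "nat \<Rightarrow> complex"
  assumes \<sigma>: "\<sigma> > 1" and g: "(\<lambda>n. \<Sum>k=1..n. u k * of_real (real k powr (- \<sigma>))) \<longlonglongrightarrow> g"
  shows "(\<lambda>n. \<Sum>m=1..n. (\<Sum>k | k dvd m. u k) * of_real (real m powr (- \<sigma>)))
     \<longlonglongrightarrow> of_real (\<Sum>m. real (Suc m) powr (- \<sigma>)) * g"
proof -
  define G where "G n = (\<Sum>k=1..n. u k * of_real (real k powr (- \<sigma>)))" for n
  define v where "v j = real j powr (- \<sigma>)" for j :: nat
  have v: "summable v" unfolding v_def using \<sigma> by (simp add: summable_real_powr_iff)
  have eq: "(\<Sum>m=1..n. (\<Sum>k | k dvd m. u k) * of_real (v m))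
      = (\<Sum>j=1..n. of_real (v j) * (G (n div j) - g)) + of_real (\<Sum>j=1..n. v j) * g" for n
  proof -
    have "(\<Sum>m=1..n. (\<Sum>k | k dvd m. u k) * of_real (v m))
        = (\<Sum>m=1..n. \<Sum>k | k dvd m. u k * of_real (v (k * (m div k))))"
      unfolding sum_distrib_right by (intro sum.cong refl) auto
    also have "\<dots> = (\<Sum>k=1..n. \<Sum>j=1..n div k. u k * of_real (v (k * j)))"
      by (rule sum_divisors_hyperbola)
    also have "\<dots> = (\<Sum>j=1..n. \<Sum>k=1..n div j. u k * of_real (v (k * j)))"
      by (rule sum_atMost_div_swap)
    also have "\<dots> = (\<Sum>j=1..n. of_real (v j) * G (n div j))"
      unfolding G_def v_def sum_distrib_left by (intro sum.cong refl) (simp add: powr_mult mult_ac)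
    finally show ?thesis by (simp add: right_diff_distrib sum_subtractf sum_distrib_right)
  qed
  have Gg: "(\<lambda>n. G n - g) \<longlonglongrightarrow> 0" using g by (simp add: G_def LIM_zero)
  then obtain M where M: "\<And>n. cmod (G n - g) \<le> M"
    using convergent_imp_Bseq[of "\<lambda>n. G n - g"] by (auto simp: convergent_def Bseq_def)
  have "(\<lambda>n. \<Sum>j=1..n. of_real (v j) * (G (n div j) - g)) \<longlonglongrightarrow> 0"
  proof (rule tannery_null[OF _ v])
    show "v j \<ge> 0" for j by (simp add: v_def)
    show "cmod (G (n div j) - g) \<le> \<bar>M\<bar> + cmod (G 0 - g)" for n j using M[of "n div j"] norm_ge_zero[of "G 0 - g"] by linarith
    show "(\<lambda>n. G (n div j) - g) \<longlonglongrightarrow> 0" if "j \<ge> 1" for j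
    proof -
      have "filterlim (\<lambda>n. n div j) sequentially sequentially"
        unfolding filterlim_at_top eventually_sequentially
      proof (intro allI exI impI)
        fix Z n assume "n \<ge> Z * j"
        then show "Z \<le> n div j" using that by (simp add: less_eq_div_iff_mult_less_eq)
      qed
      then show ?thesis by (rule filterlim_compose[OF Gg])
    qed
  qed
  moreover have "(\<lambda>n. of_real (\<Sum>j=1..n. v j) * g) \<longlonglongrightarrow> of_real (\<Sum>m. v (Suc m)) * g"
  proof -
    have "(\<lambda>m. v (Suc m)) sums (\<Sum>m. v (Suc m))" using v by (intro summable_sums) (subst summable_Suc_iff)
    then have "(\<lambda>n. \<Sum>j=1..n. v j) \<longlonglongrightarrow> (\<Sum>m. v (Suc m))" by (simp only: sums_iff_tendsto_from_1)
    then show ?thesis by (intro tendsto_mult tendsto_of_real tendsto_const)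
  qed
  ultimately have "(\<lambda>n. \<Sum>m=1..n. (\<Sum>k | k dvd m. u k) * of_real (v m)) \<longlonglongrightarrow> 0 + of_real (\<Sum>m. v (Suc m)) * g"
    unfolding eq by (rule tendsto_add)
  then show ?thesis by (simp add: v_def)
qed

section \<open>Logarithmic inequalities and growth of the means\<close>

lemma log2_le_ln:
  fixes y :: real
  assumes "y \<ge> 1"
  shows "log 2 y \<le> 3 / 2 * ln y"
proof -
  have "ln y / ln 2 \<le> ln y / (2 / 3)"
    using assms ln2_ge_two_thirds by (intro divide_left_mono) auto
  also have "\<dots> = 3 / 2 * ln y" by simp
  finally show ?thesis by (simp only: log_def)
qed

lemma log2_le_sqrt:
  fixes y :: real
  assumes "y \<ge> 1"
  shows "log 2 y \<le> 3 * sqrt y"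
proof -
  have "ln y = 2 * ln (sqrt y)" using assms by (simp add: ln_sqrt)
  also have "\<dots> \<le> 2 * sqrt y" using assms ln_le_minus_one[of "sqrt y"] by simp
  finally show ?thesis using log2_le_ln[OF assms] by linarith
qed

lemma log2_le_linear:
  fixes y :: real
  assumes "y \<ge> 1"
  shows "log 2 y \<le> 2 * y"
  using log2_le_ln[OF assms] ln_le_minus_one[of y] assms by linarith

lemma ln_le_powr:
  fixes x :: real
  assumes "x \<ge> 1" "\<eta> > 0"
  shows "ln x \<le> x powr \<eta> / \<eta>"
proof -
  have "x > 0" using assms by simp
  then have "\<eta> * ln x = ln (x powr \<eta>)" by (simp add: ln_powr)
  also have "\<dots> \<le> x powr \<eta>" using assms ln_le_minus_one[of "x powr \<eta>"] by simp
  finally show ?thesis using assms by (simp add: field_simps)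
qed

text \<open>Comparison with \<open>2 * sqrt (ln x)\<close>, an antiderivative of
  \<open>1 / (x * sqrt (ln x))\<close>.\<close>

lemma sum_inverse_sqrt_ln_le:
  assumes "n \<ge> 2"
  shows "(\<Sum>k=2..n. 1 / (real k * sqrt (ln (real k)))) \<le> 2 * sqrt (ln (real n))"
  using assms
proof (induction n rule: nat_induct_at_least)
  case base
  have l: "ln 2 \<ge> (2 / 3 :: real)" by (rule ln2_ge_two_thirds)
  have "1 / (2 * sqrt (ln 2)) \<le> 2 * sqrt (ln (2::real))"
    using l by (simp add: field_simps)
  then show ?case by simp
next
  case (Suc n)
  have l: "ln (real n) > 0" "ln (real (Suc n)) > 0" using Suc by auto
  have le: "ln (real n) \<le> ln (real (Suc n))" using Suc by simp
  have "1 / real (Suc n) \<le> ln (real (Suc n)) - ln (real n)"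
    using ln_diff_le[of "real n" "real (Suc n)"] Suc by (simp add: field_simps)
  also have "\<dots> = (sqrt (ln (real (Suc n))) - sqrt (ln (real n))) * (sqrt (ln (real (Suc n))) + sqrt (ln (real n)))"
    using l by (simp add: algebra_simps)
  also have "\<dots> \<le> (sqrt (ln (real (Suc n))) - sqrt (ln (real n))) * (2 * sqrt (ln (real (Suc n))))"
    using le by (intro mult_left_mono) auto
  finally have "1 / (real (Suc n) * sqrt (ln (real (Suc n)))) \<le> 2 * sqrt (ln (real (Suc n))) - 2 * sqrt (ln (real n))"
    using l by (simp add: field_simps del: of_nat_Suc)
  then show ?case using Suc by simp
qed

text \<open>\<open>oscillation_chain\<close> started at \<open>n0\<close> bounds the means by a
  doubly logarithmic term, weakened here to \<open>sqrt (ln m)\<close>. The sum over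
  \<open>m \<le> n0\<close> in the constant takes care of the initial values.\<close>

lemma mean_growth:
  fixes \<alpha> :: "nat \<Rightarrow> complex"
  assumes osc: "\<And>n N. n \<ge> n0 \<Longrightarrow> n \<le> N \<Longrightarrow> N \<le> n ^ 2 \<Longrightarrow> cmod (\<alpha> N - \<alpha> n) \<le> 1"
    and n0: "n0 \<ge> 2"
  obtains K where "K \<ge> 0" "\<And>m. m \<ge> 1 \<Longrightarrow> cmod (\<alpha> m) \<le> K * (1 + sqrt (ln (real m)))"
proof
  let ?K = "(\<Sum>m\<le>n0. cmod (\<alpha> m)) + 6"
  show K0: "?K \<ge> 0" by (intro add_nonneg_nonneg sum_nonneg) auto
  fix m :: nat assume m: "m \<ge> 1"
  have le: "cmod (\<alpha> k) \<le> (\<Sum>m\<le>n0. cmod (\<alpha> m))" if "k \<le> n0" for k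
    using that by (intro member_le_sum) auto
  have lm: "ln (real m) \<ge> 0" using m by simp
  show "cmod (\<alpha> m) \<le> ?K * (1 + sqrt (ln (real m)))"
  proof (cases "m \<le> n0")
    case True
    have "cmod (\<alpha> m) \<le> ?K * 1" using le[OF True] by simp
    also have "\<dots> \<le> ?K * (1 + sqrt (ln (real m)))" using K0 lm by (intro mult_left_mono) auto
    finally show ?thesis .
  next
    case False
    have "ln 2 \<le> ln (real n0)" using n0 by simp
    then have l0: "ln (real n0) \<ge> 2 / 3" using ln2_ge_two_thirds by linarith
    have l1: "ln (real m) \<ge> ln (real n0)" using False n0 by simp
    have "cmod (\<alpha> m - \<alpha> n0) \<le> 1 * (1 + log 2 (ln (real m) / ln (real n0)))"
      by (rule oscillation_chain[of n0]) (use osc n0 False in auto)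
    also have "log 2 (ln (real m) / ln (real n0)) \<le> 3 * sqrt (ln (real m) / ln (real n0))"
      using l0 l1 by (intro log2_le_sqrt) auto
    also have "sqrt (ln (real m) / ln (real n0)) \<le> sqrt (4 * ln (real m))"
    proof (intro real_sqrt_le_mono)
      have "ln (real m) / ln (real n0) \<le> ln (real m) / (2 / 3)" using l0 lm by (intro divide_left_mono) auto
      also have "\<dots> \<le> 4 * ln (real m)" using lm by simp
      finally show "ln (real m) / ln (real n0) \<le> 4 * ln (real m)" .
    qed
    also have "\<dots> = 2 * sqrt (ln (real m))" by (simp add: real_sqrt_mult)
    finally have "cmod (\<alpha> m - \<alpha> n0) \<le> 1 + 6 * sqrt (ln (real m))" by simp
    then have "cmod (\<alpha> m) \<le> cmod (\<alpha> n0) + 1 + 6 * sqrt (ln (real m))"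
      using norm_triangle_sub[of "\<alpha> m" "\<alpha> n0"] by linarith
    also have "\<dots> \<le> ?K * 1 + 6 * sqrt (ln (real m))" using le[of n0] by simp
    also have "\<dots> \<le> ?K * 1 + ?K * sqrt (ln (real m))"
      using lm by (intro add_left_mono mult_right_mono) (auto intro!: sum_nonneg)
    finally show ?thesis by (simp only: distrib_left)
  qed
qed

text \<open>After Moebius inversion the terms are at most \<open>C * (n / d) powr \<tau>\<close>,
  and the sum over \<open>d\<close> is bounded because \<open>\<tau> > 1\<close>.\<close>

lemma summatory_bound:
  fixes a :: "nat \<Rightarrow> complex"
  assumes F: "\<And>m. m \<ge> 1 \<Longrightarrow> cmod (floor_sum a m) \<le> C * real m powr \<tau>" and \<tau>: "\<tau> > 1"
  shows "cmod (\<Sum>k=1..n. a k) \<le> C * (1 + 1 / (\<tau> - 1)) * real n powr \<tau>"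
proof -
  have C: "C \<ge> 0" using order_trans[OF norm_ge_zero F[of 1]] by simp
  have "cmod (\<Sum>k=1..n. a k) \<le> (\<Sum>d=1..n. cmod (of_real (mob d) * floor_sum a (n div d)))"
    by (subst mob_summatory) (rule norm_sum)
  also have "\<dots> \<le> (\<Sum>d=1..n. C * real n powr \<tau> * real d powr (- 1 - (\<tau> - 1)))"
  proof (rule sum_mono)
    fix d assume d: "d \<in> {1..n}"
    then have nd: "n div d \<ge> 1" by (simp add: Suc_leI div_greater_zero_iff)
    have "cmod (of_real (mob d) * floor_sum a (n div d)) \<le> 1 * (C * real (n div d) powr \<tau>)"
      unfolding norm_mult using abs_mob_le[of d] F[OF nd] by (intro mult_mono) auto
    also have "\<dots> \<le> C * (real n / real d) powr \<tau>"
      using C \<tau> by (auto intro!: mult_left_mono powr_mono2 of_nat_div_le_of_nat)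
    also have "\<dots> = C * real n powr \<tau> * real d powr (- 1 - (\<tau> - 1))"
      using d by (simp add: powr_divide powr_minus field_simps)
    finally show "cmod (of_real (mob d) * floor_sum a (n div d)) \<le> C * real n powr \<tau> * real d powr (- 1 - (\<tau> - 1))" .
  qed
  also have "\<dots> = C * real n powr \<tau> * (\<Sum>d=1..n. real d powr (- 1 - (\<tau> - 1)))"
    by (simp add: sum_distrib_left)
  also have "\<dots> \<le> C * real n powr \<tau> * (1 + 1 / (\<tau> - 1))"
    using sum_powr_le[of "\<tau> - 1" n] C \<tau> by (intro mult_left_mono) auto
  finally show ?thesis by (simp add: mult_ac)
qed

lemma growth_powr:
  fixes \<alpha> :: "nat \<Rightarrow> complex"
  assumes K: "K \<ge> 0" "cmod (\<alpha> m) \<le> K * (1 + sqrt (ln (real m)))" and m: "m \<ge> 1" and \<eta>: "\<eta> > 0"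
  shows "cmod (\<alpha> m) \<le> K * (2 + 1 / \<eta>) * real m powr \<eta>"
proof -
  have lm: "ln (real m) \<ge> 0" using m by simp
  have p1: "real m powr \<eta> \<ge> 1" using m \<eta> by (intro ge_one_powr_ge_zero) auto
  have "sqrt (ln (real m)) \<le> 1 + ln (real m)"
    using lm by (intro real_le_lsqrt) (auto simp: power2_eq_square algebra_simps)
  also have "ln (real m) \<le> real m powr \<eta> / \<eta>" using m \<eta> by (intro ln_le_powr) auto
  finally have "1 + sqrt (ln (real m)) \<le> 2 * real m powr \<eta> + real m powr \<eta> / \<eta>" using p1 by linarith
  then have "K * (1 + sqrt (ln (real m))) \<le> K * (2 * real m powr \<eta> + real m powr \<eta> / \<eta>)"
    using K by (intro mult_left_mono) auto
  then show ?thesis using K by (simp add: algebra_simps)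
qed

text \<open>Partial summation of \<open>\<Sum>m. f m * m powr (-\<sigma>)\<close>, with \<open>f\<close> the divisor sum of \<open>a\<close>, exhibits
  \<open>\<zeta>(\<sigma>) g(\<sigma>)\<close> as the average of the means \<open>\<alpha> N\<close> with the weights below.\<close>

lemma averaged_oscillation:
  fixes \<alpha> :: "nat \<Rightarrow> complex"
  assumes osc: "\<And>n N. n \<ge> n0 \<Longrightarrow> n \<le> N \<Longrightarrow> N \<le> n ^ 2 \<Longrightarrow> cmod (\<alpha> N - \<alpha> n) \<le> e"
    and n0: "n0 \<ge> 2" and e: "e \<ge> 0"
    and K: "K \<ge> 0" "\<And>m. m \<ge> 1 \<Longrightarrow> cmod (\<alpha> m) \<le> K * (1 + sqrt (ln (real m)))"
    and n: "n \<ge> n0" and L: "L = ln (real n)" "L \<ge> 1"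
    and \<sigma>: "\<sigma> = 1 + 1 / L"
  shows "(\<Sum>N=1..X. cmod (\<alpha> N - \<alpha> n) * (real N * (real N powr (- \<sigma>) - real (Suc N) powr (- \<sigma>))))
     \<le> 40 * e * L + 4 * K * real n0 * (1 + sqrt L)"
proof -
  have \<sigma>12: "1 < \<sigma>" "\<sigma> \<le> 2" using L by (simp_all add: \<sigma>)
  \<comment> \<open>\<open>Z\<close> carries the oscillation factor \<open>sqrt (L / ln N)\<close>
    on the range below \<open>n\<close>. \<open>Y\<close> covers the finitely many
    \<open>N < n0\<close>, where only the growth bound is available.\<close>
  define Z where "Z N = (if 2 \<le> N \<and> N \<le> n then sqrt L * (1 / (real N * sqrt (ln (real N)))) else 0)" for N :: nat
  define Y where "Y N = (if N < n0 then 4 * K * (1 + sqrt L) else 0)" for N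
  have Z0: "Z N \<ge> 0" and Y0: "Y N \<ge> 0" for N using L K by (auto simp: Z_def Y_def)
  have w: "0 \<le> real N * (real N powr (- \<sigma>) - real (Suc N) powr (- \<sigma>))"
     "real N * (real N powr (- \<sigma>) - real (Suc N) powr (- \<sigma>)) \<le> 2 * real N powr (- \<sigma>)" if N: "N \<ge> 1" for N
  proof -
    show "0 \<le> real N * (real N powr (- \<sigma>) - real (Suc N) powr (- \<sigma>))"
      using powr_minus_antimono[of \<sigma> N] N \<sigma>12 by simp
    have "real N * (real N powr (- \<sigma>) - real (Suc N) powr (- \<sigma>)) \<le> real N * (\<sigma> * real N powr (- 1 - \<sigma>))"
      using powr_minus_diff_le[of \<sigma> N] N \<sigma>12 by (intro mult_left_mono) auto
    also have "\<dots> = \<sigma> * (real N powr 1 * real N powr (- 1 - \<sigma>))" using N by simp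
    also have "\<dots> = \<sigma> * real N powr (- \<sigma>)" by (subst powr_add[symmetric]) simp
    also have "\<dots> \<le> 2 * real N powr (- \<sigma>)" using \<sigma>12 by (intro mult_right_mono) auto
    finally show "real N * (real N powr (- \<sigma>) - real (Suc N) powr (- \<sigma>)) \<le> 2 * real N powr (- \<sigma>)" .
  qed
  have pt: "cmod (\<alpha> N - \<alpha> n) * real N powr (- \<sigma>) * 2
      \<le> 2 * e * (real N powr (- 1 - 1 / L) + 4 * real N powr (- 1 - 1 / (2 * L)) + 3 * Z N) + Y N" if N: "N \<ge> 1" for N
  proof -
    have P0: "real N powr (- \<sigma>) \<ge> 0" by simp
    have P\<sigma>: "real N powr (- \<sigma>) = real N powr (- 1 - 1 / L)" by (simp add: \<sigma> algebra_simps)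
    have P1: "real N powr (- \<sigma>) \<le> 1 / real N"
    proof -
      have "real N powr (- \<sigma>) \<le> real N powr (- 1)" using N \<sigma>12 by (intro powr_mono) auto
      then show ?thesis using N by (simp add: powr_minus_divide)
    qed
    have lN: "ln (real N) \<ge> 0" using N by simp
    \<comment> \<open>Half of the decay \<open>N powr (- 1 / L)\<close> is spent on absorbing
      \<open>ln N / L\<close>; the other half keeps the sum over \<open>N\<close> of order
      \<open>L\<close>.\<close>
    have lnP: "ln (real N) / L * real N powr (- \<sigma>) \<le> 2 * real N powr (- 1 - 1 / (2 * L))"
    proof -
      have "ln (real N) \<le> real N powr (1 / (2 * L)) / (1 / (2 * L))" using N L by (intro ln_le_powr) auto
      then have "ln (real N) / L \<le> 2 * real N powr (1 / (2 * L))" using L by (simp add: field_simps)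
      then have "ln (real N) / L * real N powr (- \<sigma>) \<le> 2 * real N powr (1 / (2 * L)) * real N powr (- \<sigma>)"
        using P0 by (rule mult_right_mono)
      also have "\<dots> = 2 * real N powr (1 / (2 * L) + (- \<sigma>))" by (simp only: powr_add mult.assoc)
      also have "1 / (2 * L) + (- \<sigma>) = - 1 - 1 / (2 * L)" using L by (simp add: \<sigma> field_simps)
      finally show ?thesis .
    qed
    consider "N \<ge> n" | "n0 \<le> N" "N < n" | "N < n0" by linarith
    then show ?thesis
    proof cases
      case 1
      have "L \<le> ln (real N)" using 1 n n0 L by simp
      then have "log 2 (ln (real N) / L) \<le> 2 * (ln (real N) / L)" using L by (intro log2_le_linear) auto
      moreover have "cmod (\<alpha> N - \<alpha> n) \<le> e * (1 + log 2 (ln (real N) / L))"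
        unfolding L by (rule oscillation_chain[of n0]) (use osc n0 n e 1 in auto)
      ultimately have "cmod (\<alpha> N - \<alpha> n) \<le> e * (1 + 2 * (ln (real N) / L))"
        using e by (meson add_left_mono mult_left_mono order_trans)
      then have "cmod (\<alpha> N - \<alpha> n) * real N powr (- \<sigma>) \<le> e * (1 + 2 * (ln (real N) / L)) * real N powr (- \<sigma>)"
        using P0 by (rule mult_right_mono)
      also have "\<dots> = e * (real N powr (- \<sigma>) + 2 * (ln (real N) / L * real N powr (- \<sigma>)))" by (simp add: algebra_simps)
      also have "\<dots> \<le> e * (real N powr (- 1 - 1 / L) + 4 * real N powr (- 1 - 1 / (2 * L)) + 3 * Z N)"
        using lnP Z0[of N] e unfolding P\<sigma> by (intro mult_left_mono) auto
      finally show ?thesis using Y0[of N] by linarith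
    next
      case 2
      then have N2: "2 \<le> N" using n0 by simp
      then have lN: "ln (real N) > 0" by simp
      have "ln (real N) \<le> L" using 2 N L by simp
      then have "log 2 (L / ln (real N)) \<le> 3 * sqrt (L / ln (real N))" using lN by (intro log2_le_sqrt) auto
      moreover have "cmod (\<alpha> n - \<alpha> N) \<le> e * (1 + log 2 (L / ln (real N)))"
        unfolding L by (rule oscillation_chain[of n0]) (use osc n0 n e 2 in auto)
      ultimately have "cmod (\<alpha> n - \<alpha> N) \<le> e * (1 + 3 * sqrt (L / ln (real N)))"
        using e by (meson add_left_mono mult_left_mono order_trans)
      then have "cmod (\<alpha> N - \<alpha> n) * real N powr (- \<sigma>) \<le> e * (1 + 3 * sqrt (L / ln (real N))) * real N powr (- \<sigma>)"
        using P0 by (subst norm_minus_commute) (rule mult_right_mono)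
      also have "\<dots> = e * (real N powr (- \<sigma>) + 3 * (sqrt (L / ln (real N)) * real N powr (- \<sigma>)))" by (simp add: algebra_simps)
      also have "\<dots> \<le> e * (real N powr (- 1 - 1 / L) + 4 * real N powr (- 1 - 1 / (2 * L)) + 3 * Z N)"
      proof -
        have "sqrt (L / ln (real N)) * real N powr (- \<sigma>) \<le> sqrt (L / ln (real N)) * (1 / real N)"
          using P1 lN L by (intro mult_left_mono) auto
        also have "\<dots> = Z N" using 2 N2 by (simp add: Z_def real_sqrt_divide)
        finally have "sqrt (L / ln (real N)) * real N powr (- \<sigma>) \<le> Z N" .
        moreover have "0 \<le> real N powr (- 1 - 1 / (2 * L))" by simp
        ultimately show ?thesis using e P\<sigma> by (intro mult_left_mono) linarith+
      qed
      finally show ?thesis using Y0[of N] by linarith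
    next
      case 3
      have sq: "sqrt (ln (real N)) \<le> sqrt L" using 3 n N L by (intro real_sqrt_le_mono) simp
      have "cmod (\<alpha> N - \<alpha> n) \<le> cmod (\<alpha> N) + cmod (\<alpha> n)" by (rule norm_triangle_ineq4)
      also have "\<dots> \<le> K * (1 + sqrt (ln (real N))) + K * (1 + sqrt (ln (real n)))"
        using N n n0 by (intro add_mono K) auto
      also have "\<dots> \<le> K * (1 + sqrt L) + K * (1 + sqrt L)"
        using sq K L(1) by (intro add_mono mult_left_mono) auto
      finally have "cmod (\<alpha> N - \<alpha> n) \<le> 2 * K * (1 + sqrt L)" by simp
      moreover have "real N powr (- \<sigma>) \<le> 1"
        using P1 N by (elim order_trans) simp
      ultimately have "cmod (\<alpha> N - \<alpha> n) * real N powr (- \<sigma>) \<le> 2 * K * (1 + sqrt L) * 1"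
        using K L by (intro mult_mono) auto
      moreover have "Y N = 2 * (2 * K * (1 + sqrt L) * 1)" using 3 by (simp add: Y_def)
      ultimately have "cmod (\<alpha> N - \<alpha> n) * real N powr (- \<sigma>) * 2 \<le> Y N" by linarith
      moreover have "0 \<le> 2 * e * (real N powr (- 1 - 1 / L) + 4 * real N powr (- 1 - 1 / (2 * L)) + 3 * Z N)"
        using e Z0[of N] by (intro mult_nonneg_nonneg add_nonneg_nonneg) auto
      ultimately show ?thesis by linarith
    qed
  qed
  have "(\<Sum>N=1..X. cmod (\<alpha> N - \<alpha> n) * (real N * (real N powr (- \<sigma>) - real (Suc N) powr (- \<sigma>))))
    \<le> (\<Sum>N=1..X. 2 * e * (real N powr (- 1 - 1 / L) + 4 * real N powr (- 1 - 1 / (2 * L)) + 3 * Z N) + Y N)"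
  proof (rule sum_mono)
    fix N assume "N \<in> {1..X}"
    then have N: "N \<ge> 1" by simp
    have "cmod (\<alpha> N - \<alpha> n) * (real N * (real N powr (- \<sigma>) - real (Suc N) powr (- \<sigma>)))
        \<le> cmod (\<alpha> N - \<alpha> n) * (2 * real N powr (- \<sigma>))"
      using w(2)[OF N] by (rule mult_left_mono) simp
    also have "\<dots> \<le> 2 * e * (real N powr (- 1 - 1 / L) + 4 * real N powr (- 1 - 1 / (2 * L)) + 3 * Z N) + Y N"
      using pt[OF N] by (simp add: mult_ac)
    finally show "cmod (\<alpha> N - \<alpha> n) * (real N * (real N powr (- \<sigma>) - real (Suc N) powr (- \<sigma>)))
        \<le> 2 * e * (real N powr (- 1 - 1 / L) + 4 * real N powr (- 1 - 1 / (2 * L)) + 3 * Z N) + Y N" .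
  qed
  also have "\<dots> = 2 * e * ((\<Sum>N=1..X. real N powr (- 1 - 1 / L)) + 4 * (\<Sum>N=1..X. real N powr (- 1 - 1 / (2 * L))) + 3 * (\<Sum>N=1..X. Z N))
      + (\<Sum>N=1..X. Y N)"
    by (simp only: sum.distrib sum_distrib_left[symmetric])
  also have "\<dots> \<le> 2 * e * ((1 + 1 / (1 / L)) + 4 * (1 + 1 / (1 / (2 * L))) + 3 * (2 * L)) + real n0 * (4 * K * (1 + sqrt L))"
  proof (intro add_mono mult_left_mono)
    show "(\<Sum>N=1..X. real N powr (- 1 - 1 / L)) \<le> 1 + 1 / (1 / L)" using L by (intro sum_powr_le) auto
    show "(\<Sum>N=1..X. real N powr (- 1 - 1 / (2 * L))) \<le> 1 + 1 / (1 / (2 * L))" using L by (intro sum_powr_le) auto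
    have "(\<Sum>N=1..X. Z N) \<le> (\<Sum>N\<in>{1..X} \<union> {2..n}. Z N)" by (intro sum_mono2) (auto simp: Z0)
    also have "\<dots> = (\<Sum>N=2..n. Z N)" by (intro sum.mono_neutral_right) (auto simp: Z_def)
    also have "\<dots> = sqrt L * (\<Sum>N=2..n. 1 / (real N * sqrt (ln (real N))))"
      unfolding sum_distrib_left by (intro sum.cong refl) (auto simp: Z_def)
    also have "\<dots> \<le> sqrt L * (2 * sqrt L)"
      unfolding L(1) using n n0 by (intro mult_left_mono sum_inverse_sqrt_ln_le) auto
    also have "\<dots> = 2 * L" using L by simp
    finally show "(\<Sum>N=1..X. Z N) \<le> 2 * L" .
    have "(\<Sum>N=1..X. Y N) \<le> (\<Sum>N\<in>{1..X} \<union> {..<n0}. Y N)" by (intro sum_mono2) (auto simp: Y0)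
    also have "\<dots> = (\<Sum>N<n0. Y N)" by (intro sum.mono_neutral_right) (auto simp: Y_def)
    also have "\<dots> = real n0 * (4 * K * (1 + sqrt L))" by (simp add: Y_def)
    finally show "(\<Sum>N=1..X. Y N) \<le> real n0 * (4 * K * (1 + sqrt L))" .
  qed (use e in auto)
  \<comment> \<open>The bracket is 5 + 15 * L, and \<open>L \<ge> 1\<close> merges the two resulting
    terms into \<open>40 * L\<close>.\<close>
  also have "2 * e * ((1 + 1 / (1 / L)) + 4 * (1 + 1 / (1 / (2 * L))) + 3 * (2 * L)) = e * (10 + 30 * L)"
    by (simp add: algebra_simps)
  also have "\<dots> \<le> e * (40 * L)" using e L by (intro mult_left_mono) auto
  finally show ?thesis by (simp add: mult_ac)
qed

section \<open>Comparison of the means with the Dirichlet series\<close>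

lemma inverse_le_zeta:
  assumes "t > 0"
  shows "1 / t \<le> (\<Sum>m. real (Suc m) powr (- (1 + t)))"
proof (rule LIMSEQ_le)
  have "(\<lambda>n. real (Suc n) powr (- t)) \<longlonglongrightarrow> 0"
    using assms by (intro tendsto_neg_powr filterlim_compose[OF filterlim_real_sequentially filterlim_Suc]) auto
  then have "(\<lambda>n. (1 - real (Suc n) powr (- t)) / t) \<longlonglongrightarrow> (1 - 0) / t"
    by (intro tendsto_divide tendsto_diff tendsto_const) (use assms in auto)
  then show "(\<lambda>n. (1 - real (Suc n) powr (- t)) / t) \<longlonglongrightarrow> 1 / t" by simp
  have "summable (\<lambda>m. real m powr (- (1 + t)))" using assms by (simp add: summable_real_powr_iff)
  then have "(\<lambda>m. real (Suc m) powr (- (1 + t))) sums (\<Sum>m. real (Suc m) powr (- (1 + t)))"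
    by (intro summable_sums) (subst summable_Suc_iff[of "\<lambda>m. real m powr (- (1 + t))"])
  then show "(\<lambda>n. \<Sum>k=1..n. real k powr (- (1 + t))) \<longlonglongrightarrow> (\<Sum>m. real (Suc m) powr (- (1 + t)))"
    by (subst (asm) sums_iff_tendsto_from_1[of "\<lambda>m. real m powr (- (1 + t))"])
  show "\<exists>N. \<forall>n\<ge>N. (1 - real (Suc n) powr (- t)) / t \<le> (\<Sum>k=1..n. real k powr (- (1 + t)))"
    using sum_powr_ge[OF assms] by (simp add: algebra_simps)
qed

text \<open>The product of \<zeta> and \<open>dser a \<sigma> - \<alpha> n\<close> is the limit of
  the weighted oscillations \<open>A X\<close>, which \<open>averaged_oscillation\<close> bounds by
  \<open>B\<close>, of order \<open>e * L + sqrt L\<close> for fixed \<open>n0\<close> and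
  \<open>K\<close>. Dividing by \<open>\<zeta> \<ge> L\<close> gives the claim.\<close>

lemma mean_minus_dser:
  fixes a :: "nat \<Rightarrow> complex"
  defines "\<alpha> \<equiv> \<lambda>n. floor_sum a n / of_nat n"
  assumes osc: "\<And>n N. n \<ge> n0 \<Longrightarrow> n \<le> N \<Longrightarrow> N \<le> n ^ 2 \<Longrightarrow> cmod (\<alpha> N - \<alpha> n) \<le> e"
    and n0: "n0 \<ge> 2" and e: "e \<ge> 0"
    and K: "K \<ge> 0" "\<And>m. m \<ge> 1 \<Longrightarrow> cmod (\<alpha> m) \<le> K * (1 + sqrt (ln (real m)))"
    and n: "n \<ge> n0" and L: "L = ln (real n)" "L \<ge> 1"
    and \<sigma>: "\<sigma> = 1 + 1 / L"
    and summ: "summable (\<lambda>m. a (Suc m) * of_real (real (Suc m) powr (- \<sigma>)))"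
  shows "cmod (\<alpha> n - dser a \<sigma>) \<le> 40 * e + 4 * K * real n0 * ((1 + sqrt L) / L)"
proof -
  have \<sigma>1: "\<sigma> > 1" using L by (simp add: \<sigma>)
  define f where "f m = (\<Sum>k | k dvd m. a k)" for m
  define c where "c = \<alpha> n"
  define v where "v m = real m powr (- \<sigma>)" for m :: nat
  define \<zeta> where "\<zeta> = (\<Sum>m. v (Suc m))"
  define B where "B = 40 * e * L + 4 * K * real n0 * (1 + sqrt L)"
  have F: "(\<Sum>i=1..m. f i) = of_nat m * \<alpha> m" for m
  proof -
    have "(\<Sum>i=1..m. f i) = floor_sum a m" unfolding f_def by (rule sum_sum_divisors)
    also have "\<dots> = of_nat m * \<alpha> m" by (cases "m = 0") (auto simp: \<alpha>_def)
    finally show ?thesis .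
  qed
  define A where "A X = (\<Sum>N=1..X. of_nat N * (\<alpha> N - c) * of_real (v N - v (Suc N)))" for X
  define R where "R X = of_nat X * (\<alpha> X - c) * of_real (v (Suc X))" for X
  \<comment> \<open>Subtracting the constant \<open>c\<close> before partial summation makes the
    partial sums \<open>m * (\<alpha> m - c)\<close>, so only deviations from
    \<open>\<alpha> n\<close> enter. \<open>R X\<close> is the boundary term.\<close>
  have parts: "(\<Sum>m=1..X. f m * of_real (v m)) - c * of_real (\<Sum>m=1..X. v m) = A X + R X" for X
  proof -
    have "(\<Sum>i=1..m. f i - c) = of_nat m * (\<alpha> m - c)" for m
      using F[of m] by (simp add: sum_subtractf right_diff_distrib)
    then have "(\<Sum>m=1..X. (f m - c) * of_real (v m)) = A X + R X"
      using sum_by_parts[of "\<lambda>m. f m - c" "\<lambda>m. of_real (v m)" X] by (simp add: A_def R_def)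
    then show ?thesis by (simp add: left_diff_distrib sum_subtractf sum_distrib_left)
  qed
  have "summable (\<lambda>m. v m)" unfolding v_def using \<sigma>1 by (simp add: summable_real_powr_iff)
  then have "(\<lambda>m. v (Suc m)) sums \<zeta>"
    unfolding \<zeta>_def by (intro summable_sums) (subst summable_Suc_iff)
  then have \<zeta>: "(\<lambda>X. \<Sum>m=1..X. v m) \<longlonglongrightarrow> \<zeta>" by (simp only: sums_iff_tendsto_from_1)
  have "(\<lambda>m. a (Suc m) * of_real (real (Suc m) powr (- \<sigma>))) sums dser a \<sigma>"
    unfolding dser_def by (rule summable_sums[OF summ])
  then have "(\<lambda>X. \<Sum>k=1..X. a k * of_real (real k powr (- \<sigma>))) \<longlonglongrightarrow> dser a \<sigma>"
    by (subst (asm) sums_iff_tendsto_from_1[of "\<lambda>k. a k * of_real (real k powr (- \<sigma>))"])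
  from dirichlet_product_one[OF \<sigma>1 this]
  have fg: "(\<lambda>X. \<Sum>m=1..X. f m * of_real (v m)) \<longlonglongrightarrow> of_real \<zeta> * dser a \<sigma>"
    by (simp add: f_def v_def \<zeta>_def)
  have R: "R \<longlonglongrightarrow> 0"
  proof (rule Lim_null_comparison)
    \<comment> \<open>With \<eta> half of \<open>\<sigma> - 1\<close>, the growth
      \<open>X powr \<eta>\<close> of the means leaves the boundary term with exponent
      \<open>1 + \<eta> - \<sigma> = - \<eta>\<close>.\<close>
    define \<eta> where "\<eta> = 1 / (2 * L)"
    have \<eta>: "\<eta> > 0" using L by (simp add: \<eta>_def)
    define D where "D = K * (2 + 1 / \<eta>) + cmod c"
    have D0: "D \<ge> 0" using K \<eta> by (simp add: D_def)
    have "((\<lambda>X. D * real X powr (- \<eta>)) \<longlongrightarrow> 0) sequentially"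
      using \<eta> by (intro tendsto_mult_right_zero tendsto_neg_powr filterlim_real_sequentially) auto
    then show "(\<lambda>X. D * real X powr (- \<eta>)) \<longlonglongrightarrow> 0" .
    show "\<forall>\<^sub>F X in sequentially. norm (R X) \<le> D * real X powr (- \<eta>)"
      using eventually_ge_at_top[of 1]
    proof eventually_elim
      case (elim X)
      have p1: "real X powr \<eta> \<ge> 1" using elim \<eta> by (intro ge_one_powr_ge_zero) auto
      have "cmod (\<alpha> X - c) \<le> cmod (\<alpha> X) + cmod c" by (rule norm_triangle_ineq4)
      also have "\<dots> \<le> K * (2 + 1 / \<eta>) * real X powr \<eta> + cmod c * real X powr \<eta>"
        using growth_powr[of K \<alpha> X \<eta>, OF K(1) K(2)[OF elim] elim \<eta>] mult_left_mono[OF p1, of "cmod c"] by simp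
      finally have 1: "cmod (\<alpha> X - c) \<le> D * real X powr \<eta>" by (simp add: D_def algebra_simps)
      have "norm (R X) = real X * cmod (\<alpha> X - c) * v (Suc X)"
        by (simp add: R_def norm_mult v_def)
      also have "\<dots> \<le> real X * (D * real X powr \<eta>) * v X"
        using 1 D0 powr_minus_antimono[of \<sigma> X] elim \<sigma>1
        by (intro mult_mono) (auto simp: v_def intro: order_trans[OF norm_ge_zero])
      also have "\<dots> = D * (real X powr 1 * real X powr \<eta> * real X powr (- \<sigma>))" using elim by (simp add: v_def)
      also have "real X powr 1 * real X powr \<eta> * real X powr (- \<sigma>) = real X powr (1 + \<eta> + (- \<sigma>))"
        by (simp only: powr_add)
      also have "1 + \<eta> + (- \<sigma>) = - \<eta>" using L by (simp add: \<eta>_def \<sigma> field_simps)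
      finally show ?case .
    qed
  qed
  have "(\<lambda>X. ((\<Sum>m=1..X. f m * of_real (v m)) - c * of_real (\<Sum>m=1..X. v m)) - R X)
      \<longlonglongrightarrow> (of_real \<zeta> * dser a \<sigma> - c * of_real \<zeta>) - 0"
    by (intro tendsto_diff tendsto_mult tendsto_const tendsto_of_real fg \<zeta> R)
  then have lim: "A \<longlonglongrightarrow> of_real \<zeta> * (dser a \<sigma> - c)"
    unfolding parts by (simp add: algebra_simps)
  have AB: "cmod (A X) \<le> B" for X
  proof -
    have "cmod (A X) \<le> (\<Sum>N=1..X. cmod (of_nat N * (\<alpha> N - c) * of_real (v N - v (Suc N))))"
      unfolding A_def by (rule norm_sum)
    also have "\<dots> = (\<Sum>N=1..X. cmod (\<alpha> N - \<alpha> n) * (real N * (real N powr (- \<sigma>) - real (Suc N) powr (- \<sigma>))))"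
    proof (intro sum.cong refl)
      fix N assume "N \<in> {1..X}"
      then have "v (Suc N) \<le> v N" unfolding v_def using \<sigma>1 by (intro powr_minus_antimono) auto
      then show "cmod (of_nat N * (\<alpha> N - c) * of_real (v N - v (Suc N)))
          = cmod (\<alpha> N - \<alpha> n) * (real N * (real N powr (- \<sigma>) - real (Suc N) powr (- \<sigma>)))"
        unfolding norm_mult norm_of_real by (simp add: v_def c_def)
    qed
    also have "\<dots> \<le> B" unfolding B_def by (rule averaged_oscillation) (fact osc n0 e K n L \<sigma>)+
    finally show ?thesis .
  qed
  have "cmod (of_real \<zeta> * (dser a \<sigma> - c)) \<le> B"
    by (rule Lim_norm_ubound[OF _ lim]) (auto simp: AB)
  moreover have "L \<le> \<zeta>"
    using inverse_le_zeta[of "1 / L"] L by (simp add: \<zeta>_def v_def \<sigma>)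
  moreover have "L * cmod (dser a \<sigma> - c) \<le> \<zeta> * cmod (dser a \<sigma> - c)"
    using \<open>L \<le> \<zeta>\<close> by (intro mult_right_mono) auto
  ultimately have "L * cmod (dser a \<sigma> - c) \<le> B" using L by (simp add: norm_mult)
  then have "cmod (dser a \<sigma> - c) \<le> B / L" using L by (simp add: pos_le_divide_eq mult.commute)
  also have "B / L = 40 * e + 4 * K * real n0 * ((1 + sqrt L) / L)"
    using L by (simp add: B_def field_simps)
  finally show ?thesis by (simp add: c_def norm_minus_commute)
qed

text \<open>The constant absorbs the finitely many indices below the threshold. Partial summation
  involves all \<open>m \<le> n\<close>, so a bound from \<open>m = 1\<close> on is
  required.\<close>

lemma smallo_uniform_bound:
  fixes T :: "nat \<Rightarrow> complex"
  assumes "T \<in> o(\<lambda>n. of_real (real n * ln (real n)))" "\<epsilon> > 0"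
  shows "\<exists>C. \<forall>m\<ge>1. cmod (T m) \<le> \<epsilon> * real m * ln (real m) + C"
proof -
  from landau_o.smallD[OF assms] obtain m0 where
    m0: "\<And>m. m \<ge> m0 \<Longrightarrow> cmod (T m) \<le> \<epsilon> * norm (complex_of_real (real m * ln (real m)))"
    by (auto simp: eventually_sequentially)
  show ?thesis
  proof (intro exI allI impI)
    fix m :: nat assume m: "m \<ge> 1"
    then have l: "0 \<le> real m * ln (real m)" by simp
    have C0: "0 \<le> (\<Sum>m<m0. cmod (T m))" by (intro sum_nonneg) auto
    show "cmod (T m) \<le> \<epsilon> * real m * ln (real m) + (\<Sum>m<m0. cmod (T m))"
    proof (cases "m < m0")
      case True
      then have "cmod (T m) \<le> (\<Sum>m<m0. cmod (T m))" by (intro member_le_sum) auto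
      moreover have "0 \<le> \<epsilon> * (real m * ln (real m))" using assms(2) l by simp
      ultimately show ?thesis by (simp add: mult.assoc)
    next
      case False
      then have "cmod (T m) \<le> \<epsilon> * (real m * ln (real m))" using m0[of m] l by (simp only: norm_of_real) simp
      then show ?thesis using C0 by (simp add: mult.assoc)
    qed
  qed
qed

theorem theorem1:
  fixes a :: "nat \<Rightarrow> complex"
  assumes hS: "(\<lambda>n. \<Sum>k\<in>{1..n}. a k * of_int \<lfloor>real n / real k\<rfloor> * of_real (ln (real k)))
                 \<in> o(\<lambda>n. of_real (real n * ln (real n)))"
  shows "(\<forall>\<sigma>::real. \<sigma> > 1 \<longrightarrow>
            summable (\<lambda>m. a (Suc m) * of_real (real (Suc m) powr (- \<sigma>))))
       \<and> (\<lambda>n. (1 / of_nat n) * (\<Sum>k\<in>{1..n}. a k * of_int \<lfloor>real n / real k\<rfloor>)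
               - dser a (1 + 1 / ln (real n))) \<in> o(\<lambda>_. 1)"
proof -
  have fl: "of_int \<lfloor>real n / real k\<rfloor> = (of_nat (n div k) :: complex)" for n k
    by (simp add: floor_divide_of_nat_eq)
  define \<alpha> where "\<alpha> n = floor_sum a n / of_nat n" for n
  have "(\<lambda>n. floor_sum (\<lambda>k. a k * of_real (ln (real k))) n) \<in> o(\<lambda>n. of_real (real n * ln (real n)))"
    using hS by (simp add: fl mult_ac)
  from smallo_uniform_bound[OF this]
  have osc_ev: "\<forall>\<^sub>F n in sequentially. \<forall>N. n \<le> N \<longrightarrow> N \<le> n ^ 2 \<longrightarrow> cmod (\<alpha> N - \<alpha> n) \<le> e" if "e > 0" for e
    unfolding \<alpha>_def using that by (intro slow_oscillation)
  have osc: "\<exists>n0\<ge>2. \<forall>n N. n \<ge> n0 \<longrightarrow> n \<le> N \<longrightarrow> N \<le> n ^ 2 \<longrightarrow> cmod (\<alpha> N - \<alpha> n) \<le> e" if e: "e > 0" for e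
  proof -
    obtain n1 where "\<And>n N. n \<ge> n1 \<Longrightarrow> n \<le> N \<Longrightarrow> N \<le> n ^ 2 \<Longrightarrow> cmod (\<alpha> N - \<alpha> n) \<le> e"
      using osc_ev[OF e] unfolding eventually_sequentially by blast
    then show ?thesis by (intro exI[of _ "max 2 n1"]) auto
  qed
  obtain n1 where "n1 \<ge> 2" "\<And>n N. n \<ge> n1 \<Longrightarrow> n \<le> N \<Longrightarrow> N \<le> n ^ 2 \<Longrightarrow> cmod (\<alpha> N - \<alpha> n) \<le> 1"
    using osc[of 1] by auto
  then obtain K where K: "K \<ge> 0" "\<And>m. m \<ge> 1 \<Longrightarrow> cmod (\<alpha> m) \<le> K * (1 + sqrt (ln (real m)))"
    using mean_growth[of n1 \<alpha>] by blast
  have summ: "summable (\<lambda>m. a (Suc m) * of_real (real (Suc m) powr (- \<sigma>)))" if \<sigma>: "\<sigma> > 1" for \<sigma>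
  proof -
    \<comment> \<open>This places the growth exponent \<open>1 + \<eta>\<close> strictly between 1,
      as \<open>summatory_bound\<close> requires, and \<sigma>, as
      \<open>dirichlet_convergent\<close> requires.\<close>
    define \<eta> where "\<eta> = (\<sigma> - 1) / 2"
    have \<eta>: "\<eta> > 0" using \<sigma> by (simp add: \<eta>_def)
    have Fb: "cmod (floor_sum a m) \<le> K * (2 + 1 / \<eta>) * real m powr (1 + \<eta>)" if m: "m \<ge> 1" for m
    proof -
      have "cmod (floor_sum a m) = real m * cmod (\<alpha> m)" using m by (simp add: \<alpha>_def norm_divide)
      also have "\<dots> \<le> real m * (K * (2 + 1 / \<eta>) * real m powr \<eta>)"
        using growth_powr[of K \<alpha> m \<eta>, OF K(1) K(2)[OF m] m \<eta>] by (intro mult_left_mono) auto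
      also have "\<dots> = K * (2 + 1 / \<eta>) * real m powr (1 + \<eta>)"
        using m by (simp add: powr_add)
      finally show ?thesis .
    qed
    show ?thesis
    proof (rule dirichlet_convergent)
      show "cmod (\<Sum>k=1..m. a k) \<le> K * (2 + 1 / \<eta>) * (1 + 1 / (1 + \<eta> - 1)) * real m powr (1 + \<eta>)" for m
        by (rule summatory_bound[OF Fb]) (use \<eta> in auto)
      show "1 + \<eta> < \<sigma>" using \<sigma> by (simp add: \<eta>_def field_simps)
    qed (use \<sigma> in auto)
  qed
  have "(\<lambda>n. \<alpha> n - dser a (1 + 1 / ln (real n))) \<in> o(\<lambda>_. 1)"
  proof (rule landau_o.smallI)
    fix \<epsilon> :: real assume \<epsilon>: "\<epsilon> > 0"
    \<comment> \<open>Oscillation at level \<open>\<epsilon> / 80\<close> makes the main error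
      \<open>40 * (\<epsilon> / 80) = \<epsilon> / 2\<close>. Both \<open>n0\<close> and
      \<open>K\<close> are fixed before \<open>n\<close> grows, so the second error term tends to
      0.\<close>
    obtain n0 where n0: "n0 \<ge> 2" "\<And>n N. n \<ge> n0 \<Longrightarrow> n \<le> N \<Longrightarrow> N \<le> n ^ 2 \<Longrightarrow> cmod (\<alpha> N - \<alpha> n) \<le> \<epsilon> / 80"
      using osc[of "\<epsilon> / 80"] \<epsilon> by auto
    have lnlim: "filterlim (\<lambda>n. ln (real n)) at_top sequentially"
      by (rule filterlim_compose[OF ln_at_top filterlim_real_sequentially])
    have "((\<lambda>x::real. (1 + sqrt x) / x) \<longlongrightarrow> 0) at_top" by real_asymp
    from filterlim_compose[OF this lnlim]
    have "(\<lambda>n. 4 * K * real n0 * ((1 + sqrt (ln (real n))) / ln (real n))) \<longlonglongrightarrow> 0"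
      by (rule tendsto_mult_right_zero)
    then have "\<forall>\<^sub>F n in sequentially. 4 * K * real n0 * ((1 + sqrt (ln (real n))) / ln (real n)) < \<epsilon> / 2"
      using \<epsilon> by (intro order_tendstoD(2)[of _ 0]) auto
    moreover have "\<forall>\<^sub>F n in sequentially. ln (real n) \<ge> 1" using lnlim by (auto simp: filterlim_at_top)
    ultimately show "\<forall>\<^sub>F n in sequentially. norm (\<alpha> n - dser a (1 + 1 / ln (real n))) \<le> \<epsilon> * norm (1::complex)"
      using eventually_ge_at_top[of n0]
    proof eventually_elim
      case (elim n)
      have "summable (\<lambda>m. a (Suc m) * of_real (real (Suc m) powr (- (1 + 1 / ln (real n)))))"
        by (rule summ) (use elim in simp)
      then have "cmod (\<alpha> n - dser a (1 + 1 / ln (real n)))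
          \<le> 40 * (\<epsilon> / 80) + 4 * K * real n0 * ((1 + sqrt (ln (real n))) / ln (real n))"
        unfolding \<alpha>_def
        by (intro mean_minus_dser) (use n0 \<epsilon> K elim in \<open>auto simp: \<alpha>_def\<close>)
      then show ?case using elim by simp
    qed
  qed
  then have "(\<lambda>n. (1 / of_nat n) * (\<Sum>k\<in>{1..n}. a k * of_int \<lfloor>real n / real k\<rfloor>)
               - dser a (1 + 1 / ln (real n))) \<in> o(\<lambda>_. 1)"
    by (simp add: \<alpha>_def fl)
  with summ show ?thesis by blast
qed

end
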